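(* Let $\varphi(z)=\dfrac{az+b}{cz+d}$ be a nonconstant linear-fractional selfmap of the open unit disk $\mathbb{D}$, and let $\sigma(z)=\dfrac{\overline{a}z-\overline{c}}{-\overline{b}z+\overline{d}}$ be its adjoint selfmap of $\mathbb{D}$, so that $C_\varphi^*=T_gC_\sigma T_h^*$ on $H^2$, where $g(z)=\dfrac{1}{-\overline{b}z+\overline{d}}$ and $h(z)=cz+d$ are bounded analytic functions on $\mathbb{D}$. (a) If $C_\varphi:H^2\to H^2$ is posinormal, then the linear-fractional function $\varphi\circ\sigma^{-1}$ is an analytic selfmap of $\mathbb{D}$. (b) If $\varphi$ vanishes at a point of $\mathbb{D}$ and $\varphi\circ\sigma^{-1}$ is a selfmap of $\mathbb{D}$, then $C_\varphi$ is posinormal.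
   Context: $H^2$ is the Hilbert space of analytic functions $f(z)=\sum_{n\ge 0}a_nz^n$ on $\mathbb{D}$ with $\|f\|^2=\sum|a_n|^2<\infty$; $C_\varphi f=f\circ\varphi$ (bounded on $H^2$); for a bounded analytic function $\psi$ on $\mathbb{D}$, $T_\psi f=\psi f$ on $H^2$. The identity $C_\varphi^*=T_gC_\sigma T_h^*$ is Cowen's (known) adjoint formula, which includes the fact that $\sigma$ is an analytic selfmap of $\mathbb{D}$. All nonconstant linear-fractional maps are regarded as bijections of the extended complex plane $\mathbb{C}_\infty$, so $\sigma^{-1}$ is the inverse on $\mathbb{C}_\infty$, and "$\varphi\circ\sigma^{-1}$ is a selfmap of $\mathbb{D}$" means $(\varphi\circ\sigma^{-1})(\mathbb{D})\subseteq\mathbb{D}$. A bounded linear operator $A$ on a Hilbert space is posinormal if there is a positive operator $P$ with $AA^*=A^*PA$ (equivalently, $\operatorname{ran}A\subseteq\operatorname{ran}A^*$). *)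

theory Defs
  imports "HOL-Complex_Analysis.Complex_Analysis"
begin

section \<open>Linear-fractional maps of the extended complex plane\<close>

datatype extended_complex = Fin (the_fin: complex) | Infty

text \<open>
  The map \<open>z \<mapsto> (a z + b) / (c z + d)\<close> on the extended plane. This is the intended map only when
  \<open>a d - b c \<noteq> 0\<close>; see \<open>bij_linear_fractional\<close> and \<open>linear_fractional_nonconstant\<close>.
\<close>

fun linear_fractional ::
  "complex \<Rightarrow> complex \<Rightarrow> complex \<Rightarrow> complex \<Rightarrow> extended_complex \<Rightarrow> extended_complex" where
  "linear_fractional a b c d (Fin z) =
     (if c * z + d = 0 then Infty else Fin ((a * z + b) / (c * z + d)))"
| "linear_fractional a b c d Infty = (if c = 0 then Infty else Fin (a / c))"

abbreviation unit_disk :: "complex set" where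
  "unit_disk \<equiv> ball 0 1"

definition disk_selfmap :: "(extended_complex \<Rightarrow> extended_complex) \<Rightarrow> bool" where
  "disk_selfmap F \<longleftrightarrow> F ` (Fin ` unit_disk) \<subseteq> Fin ` unit_disk"

text \<open>\<open>the_fin Infty\<close> is unspecified, so \<open>on_disk F\<close> is meaningful only if \<open>F\<close> is finite on the disk.\<close>

definition on_disk :: "(extended_complex \<Rightarrow> extended_complex) \<Rightarrow> complex \<Rightarrow> complex" where
  "on_disk F z = the_fin (F (Fin z))"

definition analytic_disk_selfmap :: "(extended_complex \<Rightarrow> extended_complex) \<Rightarrow> bool" where
  "analytic_disk_selfmap F \<longleftrightarrow> disk_selfmap F \<and> on_disk F holomorphic_on unit_disk"

definition bounded_analytic :: "(complex \<Rightarrow> complex) \<Rightarrow> bool" where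
  "bounded_analytic \<psi> \<longleftrightarrow> \<psi> holomorphic_on unit_disk \<and> bounded (\<psi> ` unit_disk)"

lemma linear_fractional_inverse:
  assumes "a * d - b * c \<noteq> 0"
  shows "linear_fractional d (- b) (- c) a (linear_fractional a b c d w) = w"
proof (cases w)
  case (Fin z)
  show ?thesis
  proof (cases "c * z + d = 0")
    case True
    then have d: "d = - (c * z)"
      by (metis minus_unique)
    from d assms have c: "c \<noteq> 0" by auto
    have "d / - c = z" using d c by simp
    with Fin True c show ?thesis by simp
  next
    case False
    have den: "- c * ((a * z + b) / (c * z + d)) + a = (a * d - b * c) / (c * z + d)"
      using False by (simp add: add_divide_eq_iff divide_add_eq_iff algebra_simps)
    have num: "d * ((a * z + b) / (c * z + d)) + - b = (a * d - b * c) * z / (c * z + d)"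
      using False by (simp add: divide_diff_eq_iff algebra_simps)
    have "linear_fractional d (- b) (- c) a (linear_fractional a b c d (Fin z)) =
      (if - c * ((a * z + b) / (c * z + d)) + a = 0 then Infty
       else Fin ((d * ((a * z + b) / (c * z + d)) + - b) /
                 (- c * ((a * z + b) / (c * z + d)) + a)))"
      using False by simp
    also have "\<dots> = Fin z"
      unfolding den num using False assms by simp
    finally show ?thesis using Fin by simp
  qed
next
  case Infty
  with assms show ?thesis by auto
qed

lemma bij_linear_fractional:
  assumes "a * d - b * c \<noteq> 0"
  shows "bij (linear_fractional a b c d)"
proof (rule o_bij)
  show "linear_fractional d (- b) (- c) a \<circ> linear_fractional a b c d = id"
    using linear_fractional_inverse[OF assms] by auto
  have "d * a - (- b) * (- c) \<noteq> 0"
    using assms by (simp add: mult.commute)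
  from linear_fractional_inverse[OF this]
  show "linear_fractional a b c d \<circ> linear_fractional d (- b) (- c) a = id"
    by auto
qed

lemma linear_fractional_nonconstant:
  assumes "disk_selfmap (linear_fractional a b c d)"
  shows "\<not> linear_fractional a b c d constant_on (Fin ` unit_disk) \<longleftrightarrow> a * d - b * c \<noteq> 0"
proof -
  have nz: "c * z + d \<noteq> 0" if "z \<in> unit_disk" for z
  proof
    assume "c * z + d = 0"
    then have "linear_fractional a b c d (Fin z) = Infty" by simp
    moreover have "linear_fractional a b c d (Fin z) \<in> Fin ` unit_disk"
      using assms that by (auto simp: disk_selfmap_def simp del: linear_fractional.simps)
    ultimately show False by auto
  qed
  have d0: "d \<noteq> 0" using nz[of 0] by simp
  show ?thesis
  proof
    assume nc: "\<not> linear_fractional a b c d constant_on (Fin ` unit_disk)"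
    show "a * d - b * c \<noteq> 0"
    proof
      assume eq: "a * d - b * c = 0"
      have "linear_fractional a b c d (Fin z) = Fin (b / d)" if "z \<in> unit_disk" for z
      proof -
        have "(a * z + b) * d = b * (c * z + d)" using eq by (simp add: algebra_simps)
        then show ?thesis using nz[OF that] d0 by (simp add: frac_eq_eq)
      qed
      then have "linear_fractional a b c d constant_on (Fin ` unit_disk)"
        unfolding constant_on_def by blast
      with nc show False ..
    qed
  next
    assume ne: "a * d - b * c \<noteq> 0"
    show "\<not> linear_fractional a b c d constant_on (Fin ` unit_disk)"
    proof
      assume "linear_fractional a b c d constant_on (Fin ` unit_disk)"
      then obtain y where "\<And>z. z \<in> unit_disk \<Longrightarrow> linear_fractional a b c d (Fin z) = y"
        unfolding constant_on_def by blast
      then have "linear_fractional a b c d (Fin 0) = linear_fractional a b c d (Fin (1/2))"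
        by (simp del: linear_fractional.simps)
      then have "Fin (0::complex) = Fin (1/2)"
        by (rule injD[OF bij_is_inj[OF bij_linear_fractional[OF ne]]])
      then show False by simp
    qed
  qed
qed


section \<open>The Hilbert space \<open>H\<^sup>2\<close>\<close>

text \<open>
  An element of \<open>H\<^sup>2\<close> is represented by the function on the whole plane that extends it by \<open>0\<close>
  outside the disk, so that equality in \<open>H\<^sup>2\<close> is equality of functions.
\<close>

definition taylor_coeff :: "(complex \<Rightarrow> complex) \<Rightarrow> nat \<Rightarrow> complex" where
  "taylor_coeff f n = (deriv ^^ n) f 0 / fact n"

definition H2 :: "(complex \<Rightarrow> complex) set" where
  "H2 = {f. f holomorphic_on unit_disk \<and> (\<forall>z. z \<notin> unit_disk \<longrightarrow> f z = 0) \<and>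
            summable (\<lambda>n. (cmod (taylor_coeff f n))\<^sup>2)}"

definition H2_inner :: "(complex \<Rightarrow> complex) \<Rightarrow> (complex \<Rightarrow> complex) \<Rightarrow> complex" where
  "H2_inner f g = (\<Sum>n. taylor_coeff f n * cnj (taylor_coeff g n))"

definition H2_norm :: "(complex \<Rightarrow> complex) \<Rightarrow> real" where
  "H2_norm f = sqrt (\<Sum>n. (cmod (taylor_coeff f n))\<^sup>2)"

type_synonym operator = "(complex \<Rightarrow> complex) \<Rightarrow> (complex \<Rightarrow> complex)"

definition bounded_operator :: "operator \<Rightarrow> bool" where
  "bounded_operator A \<longleftrightarrow>
     (\<forall>f\<in>H2. A f \<in> H2) \<and>
     (\<forall>f\<in>H2. \<forall>g\<in>H2. A (\<lambda>z. f z + g z) = (\<lambda>z. A f z + A g z)) \<and>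
     (\<forall>k. \<forall>f\<in>H2. A (\<lambda>z. k * f z) = (\<lambda>z. k * A f z)) \<and>
     (\<exists>K. \<forall>f\<in>H2. H2_norm (A f) \<le> K * H2_norm f)"

text \<open>
  Only meaningful for bounded \<open>A\<close> and \<open>f \<in> H2\<close>, where the Riesz representation theorem gives a
  unique such \<open>g\<close>.
\<close>

definition adjoint_operator :: "operator \<Rightarrow> operator" where
  "adjoint_operator A f = (THE g. g \<in> H2 \<and> (\<forall>k\<in>H2. H2_inner (A k) f = H2_inner k g))"

definition positive_operator :: "operator \<Rightarrow> bool" where
  "positive_operator P \<longleftrightarrow>
     bounded_operator P \<and> (\<forall>f\<in>H2. H2_inner (P f) f \<in> \<real> \<and> 0 \<le> Re (H2_inner (P f) f))"

definition posinormal :: "operator \<Rightarrow> bool" where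
  "posinormal A \<longleftrightarrow>
     bounded_operator A \<and>
     (\<exists>P. positive_operator P \<and>
          (\<forall>f\<in>H2. A (adjoint_operator A f) = adjoint_operator A (P (A f))))"

definition composition_operator :: "(complex \<Rightarrow> complex) \<Rightarrow> operator" where
  "composition_operator \<phi> f = (\<lambda>z. if z \<in> unit_disk then f (\<phi> z) else 0)"

text \<open>No case distinction is needed here, since \<open>f\<close> vanishes outside the disk.\<close>

definition multiplication_operator :: "(complex \<Rightarrow> complex) \<Rightarrow> operator" where
  "multiplication_operator \<psi> f = (\<lambda>z. \<psi> z * f z)"

end

theory Submission
  imports Defs
begin

text \<open>
  Everything is done with Taylor coefficients and the kernels \<open>k\<^sub>w z = 1 / (1 - cnj w * z)\<close>; since all
  maps are linear-fractional, no boundary integrals are needed. A linear-fractional \<open>\<phi>\<close> with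
  \<open>\<bar>\<phi>\<bar> \<le> 1\<close> is a contractive multiplier because, for \<open>f = (c z + d) e\<close>, the inequality
  \<open>\<parallel>(a z + b) e\<parallel> \<le> \<parallel>(c z + d) e\<parallel>\<close> involves only \<open>\<parallel>e\<parallel>\<close> and \<open>\<langle>z e, e\<rangle>\<close>.
  Cowen's formula follows from \<open>C\<^sub>\<phi> k\<^sub>w = cnj (g w) \<cdot> h \<cdot> k\<^sub>v\<close> with \<open>v = \<sigma> w\<close>.

  Put \<open>\<tau> = \<phi> \<circ> \<sigma>\<^sup>-\<^sup>1\<close>. If \<open>\<tau>\<close> is a selfmap and \<open>\<phi>\<close> has a zero in the disk, then
  \<open>q = 1 / (g \<circ> \<sigma>\<^sup>-\<^sup>1)\<close> is bounded and \<open>C\<^sub>\<phi> = C\<^sub>\<phi>\<^sup>* X\<close> for the bounded operator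
  \<open>X f = (T\<^sub>h\<^sup>*)\<^sup>-\<^sup>1 (q \<cdot> (f \<circ> \<tau>))\<close>, so \<open>P = X X\<^sup>*\<close> works. Conversely, posinormality gives
  \<open>C\<^sub>\<phi> v = C\<^sub>\<phi>\<^sup>* u\<close> with \<open>\<parallel>u\<parallel> \<le> const \<parallel>v\<parallel>\<close> for \<open>v\<close> in the range of \<open>C\<^sub>\<phi>\<^sup>*\<close>. This is applied to
  \<open>v\<^sub>n = g B\<^sup>n\<close>, where \<open>B\<close> is the Blaschke factor vanishing at \<open>\<phi> 0\<close>: it yields \<open>F\<^sub>n \<in> H\<^sup>2\<close> of
  bounded norm with \<open>F\<^sub>n = F\<^sub>0 \<cdot> (B \<circ> \<tau>)\<^sup>n\<close>, so \<open>F\<^sub>0\<close> would vanish on the open set where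
  \<open>\<bar>B \<circ> \<tau>\<bar> > 1\<close>; but \<open>F\<^sub>0\<close> is not identically zero.
\<close>

section \<open>\<open>H\<^sup>2\<close> as a space of square-summable coefficients\<close>

lemma taylor_coeff_sums:
  assumes "f holomorphic_on unit_disk" "z \<in> unit_disk"
  shows "(\<lambda>n. taylor_coeff f n * z ^ n) sums f z"
  using holomorphic_power_series[OF assms] by (simp add: taylor_coeff_def)

text \<open>Uniqueness of power series: convergence at the real points of the disk gives radius at
  least 1, so the series is the expansion of \<open>f\<close> at 0. This identifies coefficients
  without differentiating.\<close>

lemma power_series_taylor:
  assumes "\<And>z. z \<in> unit_disk \<Longrightarrow> (\<lambda>n. a n * z ^ n) sums f z"
  shows "f holomorphic_on unit_disk"
    and taylor_coeff_eqI: "taylor_coeff f n = a n"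
proof -
  show "f holomorphic_on unit_disk"
    using power_series_holomorphic[of 0 1 a f] assms by simp
  have "conv_radius a \<ge> 1"
  proof (rule conv_radius_geI_ex)
    fix r :: real assume "0 < r" "ereal r < 1"
    then have "summable (\<lambda>n. a n * (of_real r) ^ n)"
      using assms[of "of_real r"] by (simp add: sums_iff)
    then show "\<exists>z. norm z = r \<and> summable (\<lambda>n. a n * z ^ n)"
      using \<open>0 < r\<close> by (intro exI[of _ "of_real r"]) auto
  qed
  then have "fps_conv_radius (Abs_fps a) > 0"
    by (simp add: fps_conv_radius_def less_le_trans[of 0 1])
  moreover have "\<forall>\<^sub>F z in nhds 0. eval_fps (Abs_fps a) z = f z"
  proof (rule eventually_nhds_in_open[of unit_disk 0, THEN eventually_mono])
    fix z :: complex assume "z \<in> unit_disk"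
    from sums_unique[OF assms[OF this]] show "eval_fps (Abs_fps a) z = f z"
      by (simp add: eval_fps_def)
  qed auto
  ultimately have "f has_fps_expansion Abs_fps a"
    by (simp add: has_fps_expansion_def)
  then show "taylor_coeff f n = a n"
    using fps_nth_fps_expansion by (fastforce simp: taylor_coeff_def)
qed

lemma
  assumes "f \<in> H2"
  shows H2_holomorphic: "f holomorphic_on unit_disk"
    and H2_outside: "z \<notin> unit_disk \<Longrightarrow> f z = 0"
    and H2_summable: "summable (\<lambda>n. (cmod (taylor_coeff f n))\<^sup>2)"
    and H2_sums: "z \<in> unit_disk \<Longrightarrow> (\<lambda>n. taylor_coeff f n * z ^ n) sums f z"
  using assms taylor_coeff_sums by (auto simp: H2_def)

lemma H2I:
  assumes "\<And>z. z \<in> unit_disk \<Longrightarrow> (\<lambda>n. a n * z ^ n) sums f z"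
    and "\<And>z. z \<notin> unit_disk \<Longrightarrow> f z = 0"
    and "summable (\<lambda>n. (cmod (a n))\<^sup>2)"
  shows "f \<in> H2"
proof -
  have "f holomorphic_on unit_disk" "\<And>n. taylor_coeff f n = a n"
    using power_series_taylor[of a f] assms(1) by blast+
  then show ?thesis using assms(2,3) by (simp add: H2_def)
qed

lemma H2_eqI:
  assumes "f \<in> H2" "g \<in> H2" "\<And>n. taylor_coeff f n = taylor_coeff g n"
  shows "f = g"
proof
  fix z show "f z = g z"
  proof (cases "z \<in> unit_disk")
    case True
    from H2_sums[OF assms(1) True] H2_sums[OF assms(2) True] show ?thesis
      by (simp add: assms(3) sums_unique2)
  next
    case False
    then show ?thesis using assms H2_outside by metis
  qed
qed

lemma summable_square_mult:
  fixes x y :: "nat \<Rightarrow> 'a::{real_normed_algebra,banach}"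
  assumes "summable (\<lambda>n. (norm (x n))\<^sup>2)" "summable (\<lambda>n. (norm (y n))\<^sup>2)"
  shows "summable (\<lambda>n. norm (x n) * norm (y n))" "summable (\<lambda>n. x n * y n)"
proof -
  show *: "summable (\<lambda>n. norm (x n) * norm (y n))"
  proof (rule summable_comparison_test'[OF summable_add[OF assms], of 0])
    fix n
    show "norm (norm (x n) * norm (y n)) \<le> (norm (x n))\<^sup>2 + (norm (y n))\<^sup>2"
      using sum_squares_bound[of "norm (x n)" "norm (y n)"]
        mult_nonneg_nonneg[OF norm_ge_zero[of "x n"] norm_ge_zero[of "y n"]]
      by (simp del: mult_nonneg_nonneg zero_le_mult_iff)
  qed
  show "summable (\<lambda>n. x n * y n)"
    by (rule summable_comparison_test'[OF *, of 0]) (simp add: norm_mult_ineq)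
qed

lemma summable_square_geometric:
  fixes z :: complex
  assumes "z \<in> unit_disk"
  shows "summable (\<lambda>n. (cmod (z ^ n))\<^sup>2)"
    and "(\<Sum>n. (cmod (z ^ n))\<^sup>2) = 1 / (1 - (cmod z)\<^sup>2)"
proof -
  have eq: "(\<lambda>n. (cmod (z ^ n))\<^sup>2) = (\<lambda>n. ((cmod z)\<^sup>2) ^ n)"
    by (simp add: norm_power power_mult [symmetric] mult.commute)
  have "norm ((cmod z)\<^sup>2) < 1" using assms by (simp add: abs_square_less_1)
  then show "summable (\<lambda>n. (cmod (z ^ n))\<^sup>2)"
    and "(\<Sum>n. (cmod (z ^ n))\<^sup>2) = 1 / (1 - (cmod z)\<^sup>2)"
    unfolding eq by (auto intro: summable_geometric simp: suminf_geometric)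
qed

text \<open>Inverse of the coefficient map; it stands in for completeness of \<open>H2\<close> in
  the Riesz argument.\<close>

definition H2_series :: "(nat \<Rightarrow> complex) \<Rightarrow> complex \<Rightarrow> complex" where
  "H2_series a = (\<lambda>z. if z \<in> unit_disk then \<Sum>n. a n * z ^ n else 0)"

lemma H2_series:
  assumes "summable (\<lambda>n. (cmod (a n))\<^sup>2)"
  shows H2_series_in_H2: "H2_series a \<in> H2"
    and taylor_coeff_H2_series: "taylor_coeff (H2_series a) n = a n"
proof -
  have *: "(\<lambda>n. a n * z ^ n) sums H2_series a z" if "z \<in> unit_disk" for z
    using that summable_square_mult(2)[OF assms summable_square_geometric(1)[OF that]]
    by (auto simp: H2_series_def intro: summable_sums)
  show "H2_series a \<in> H2"
    by (rule H2I[OF *]) (auto simp: H2_series_def assms)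
  show "taylor_coeff (H2_series a) n = a n"
    by (rule taylor_coeff_eqI[OF *])
qed

lemma taylor_coeff_add:
  assumes "f holomorphic_on unit_disk" "g holomorphic_on unit_disk"
  shows "taylor_coeff (\<lambda>z. f z + g z) n = taylor_coeff f n + taylor_coeff g n"
  by (rule taylor_coeff_eqI)
    (use assms in \<open>auto simp: distrib_right intro!: sums_add taylor_coeff_sums\<close>)

lemma taylor_coeff_diff:
  assumes "f holomorphic_on unit_disk" "g holomorphic_on unit_disk"
  shows "taylor_coeff (\<lambda>z. f z - g z) n = taylor_coeff f n - taylor_coeff g n"
  by (rule taylor_coeff_eqI)
    (use assms in \<open>auto simp: left_diff_distrib intro!: sums_diff taylor_coeff_sums\<close>)

lemma taylor_coeff_cmult:
  assumes "f holomorphic_on unit_disk"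
  shows "taylor_coeff (\<lambda>z. k * f z) n = k * taylor_coeff f n"
  by (rule taylor_coeff_eqI)
    (use assms in \<open>auto simp: mult.assoc intro!: sums_mult taylor_coeff_sums\<close>)

lemma taylor_coeff_zero [simp]: "taylor_coeff (\<lambda>z. 0) n = 0"
  by (rule taylor_coeff_eqI) simp

text \<open>Estimates are proved on finite sections, where the inequalities for
  \<open>L2_set\<close> apply before summability is known; this passes to the whole sequence and
  yields membership and norm bound together.\<close>

lemma summable_square_boundedI:
  fixes a :: "nat \<Rightarrow> complex"
  assumes "\<And>N. L2_set (\<lambda>n. cmod (a n)) {..<N} \<le> C"
  shows "summable (\<lambda>n. (cmod (a n))\<^sup>2)" "sqrt (\<Sum>n. (cmod (a n))\<^sup>2) \<le> C"
proof -
  have "0 \<le> C" using assms[of 0] by simp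
  have le: "(\<Sum>n<N. (cmod (a n))\<^sup>2) \<le> C\<^sup>2" for N
    using assms[of N] \<open>0 \<le> C\<close> by (metis L2_set_def real_sqrt_le_iff real_sqrt_unique)
  show s: "summable (\<lambda>n. (cmod (a n))\<^sup>2)"
    by (rule summableI_nonneg_bounded[OF _ le]) simp
  show "sqrt (\<Sum>n. (cmod (a n))\<^sup>2) \<le> C"
    using suminf_le_const[OF s le] \<open>0 \<le> C\<close> by (simp add: real_le_lsqrt suminf_nonneg s)
qed

lemma L2_set_le_H2_norm:
  assumes "f \<in> H2"
  shows "L2_set (\<lambda>n. cmod (taylor_coeff f n)) {..<N} \<le> H2_norm f"
  unfolding H2_norm_def L2_set_def
  by (intro real_sqrt_le_mono sum_le_suminf H2_summable assms) auto

lemma H2_norm_nonneg: "f \<in> H2 \<Longrightarrow> 0 \<le> H2_norm f"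
  using L2_set_le_H2_norm[of f 0] by simp

lemma H2_norm_square: "f \<in> H2 \<Longrightarrow> (H2_norm f)\<^sup>2 = (\<Sum>n. (cmod (taylor_coeff f n))\<^sup>2)"
  by (simp add: H2_norm_def suminf_nonneg H2_summable)

section \<open>Linear structure and inner product of \<open>H2\<close>\<close>

lemma L2_set_cmod_add:
  "L2_set (\<lambda>n. cmod (x n + y n)) A \<le> L2_set (\<lambda>n. cmod (x n)) A + L2_set (\<lambda>n. cmod (y n)) A"
  by (rule order_trans[OF L2_set_mono[where g="\<lambda>n. cmod (x n) + cmod (y n)"]])
    (auto simp: norm_triangle_ineq L2_set_triangle_ineq)

lemma H2_add:
  assumes "f \<in> H2" "g \<in> H2"
  shows "(\<lambda>z. f z + g z) \<in> H2" "H2_norm (\<lambda>z. f z + g z) \<le> H2_norm f + H2_norm g"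
proof -
  have tc: "taylor_coeff (\<lambda>z. f z + g z) n = taylor_coeff f n + taylor_coeff g n" for n
    by (simp add: taylor_coeff_add H2_holomorphic assms)
  have "L2_set (\<lambda>n. cmod (taylor_coeff f n + taylor_coeff g n)) {..<N} \<le> H2_norm f + H2_norm g" for N
    by (rule order_trans[OF L2_set_cmod_add add_mono[OF L2_set_le_H2_norm L2_set_le_H2_norm]]) fact+
  note * = summable_square_boundedI[OF this]
  show "(\<lambda>z. f z + g z) \<in> H2"
    by (rule H2I[OF _ _ *(1)]) (auto simp: distrib_right H2_outside assms intro!: sums_add H2_sums)
  show "H2_norm (\<lambda>z. f z + g z) \<le> H2_norm f + H2_norm g"
    unfolding H2_norm_def[of "\<lambda>z. f z + g z"] tc by (rule *(2))
qed

lemma H2_cmult: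
  assumes "f \<in> H2"
  shows "(\<lambda>z. k * f z) \<in> H2" "H2_norm (\<lambda>z. k * f z) = cmod k * H2_norm f"
proof -
  have *: "(\<lambda>n. (cmod (k * taylor_coeff f n))\<^sup>2) = (\<lambda>n. (cmod k)\<^sup>2 * (cmod (taylor_coeff f n))\<^sup>2)"
    by (simp add: norm_mult power_mult_distrib)
  have "summable (\<lambda>n. (cmod (k * taylor_coeff f n))\<^sup>2)"
    unfolding * by (intro summable_mult H2_summable assms)
  then show "(\<lambda>z. k * f z) \<in> H2"
    by (rule H2I[rotated -1]) (auto simp: mult.assoc H2_outside assms intro!: sums_mult H2_sums)
  show "H2_norm (\<lambda>z. k * f z) = cmod k * H2_norm f"
    by (simp add: H2_norm_def taylor_coeff_cmult H2_holomorphic assms * suminf_mult H2_summable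
        real_sqrt_mult)
qed

lemma H2_zero [simp]: "(\<lambda>z. 0) \<in> H2" "H2_norm (\<lambda>z. 0) = 0"
  by (auto simp: H2_def H2_norm_def)

lemma H2_diff:
  assumes "f \<in> H2" "g \<in> H2"
  shows "(\<lambda>z. f z - g z) \<in> H2"
  using H2_add(1)[OF assms(1) H2_cmult(1)[OF assms(2), of "- 1"]] by simp

lemma H2_inner_summable:
  assumes "f \<in> H2" "g \<in> H2"
  shows "summable (\<lambda>n. taylor_coeff f n * cnj (taylor_coeff g n))"
  using summable_square_mult(2)[of "taylor_coeff f" "\<lambda>n. cnj (taylor_coeff g n)"]
    H2_summable assms by simp

text \<open>Cauchy-Schwarz on finite sections, then the limit.\<close>

lemma H2_inner_bound:
  assumes "f \<in> H2" "g \<in> H2"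
  shows "cmod (H2_inner f g) \<le> H2_norm f * H2_norm g"
proof (rule LIMSEQ_le_const2)
  show "(\<lambda>N. cmod (\<Sum>n<N. taylor_coeff f n * cnj (taylor_coeff g n))) \<longlonglongrightarrow> cmod (H2_inner f g)"
    unfolding H2_inner_def by (intro tendsto_norm summable_LIMSEQ H2_inner_summable assms)
  have "cmod (\<Sum>n<N. taylor_coeff f n * cnj (taylor_coeff g n)) \<le> H2_norm f * H2_norm g" for N
  proof -
    have "cmod (\<Sum>n<N. taylor_coeff f n * cnj (taylor_coeff g n))
      \<le> (\<Sum>n<N. \<bar>cmod (taylor_coeff f n)\<bar> * \<bar>cmod (taylor_coeff g n)\<bar>)"
      by (rule sum_norm_le) (simp add: norm_mult)
    also have "\<dots> \<le> L2_set (\<lambda>n. cmod (taylor_coeff f n)) {..<N} * L2_set (\<lambda>n. cmod (taylor_coeff g n)) {..<N}"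
      by (rule L2_set_mult_ineq)
    also have "\<dots> \<le> H2_norm f * H2_norm g"
      by (intro mult_mono L2_set_le_H2_norm assms H2_norm_nonneg L2_set_nonneg)
    finally show ?thesis .
  qed
  then show "\<exists>N. \<forall>n\<ge>N. cmod (\<Sum>n<n. taylor_coeff f n * cnj (taylor_coeff g n)) \<le> H2_norm f * H2_norm g"
    by blast
qed

lemma H2_inner_add_left:
  assumes "f \<in> H2" "g \<in> H2" "k \<in> H2"
  shows "H2_inner (\<lambda>z. f z + g z) k = H2_inner f k + H2_inner g k"
  by (simp add: H2_inner_def taylor_coeff_add H2_holomorphic assms distrib_right suminf_add
      H2_inner_summable)

lemma H2_inner_cmult_left:
  assumes "f \<in> H2" "k \<in> H2"
  shows "H2_inner (\<lambda>z. c * f z) k = c * H2_inner f k"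
  by (simp add: H2_inner_def taylor_coeff_cmult H2_holomorphic assms mult.assoc suminf_mult
      H2_inner_summable)

lemma H2_inner_commute:
  assumes "f \<in> H2" "g \<in> H2"
  shows "H2_inner f g = cnj (H2_inner g f)"
proof -
  have "(\<lambda>n. cnj (taylor_coeff g n * cnj (taylor_coeff f n))) sums cnj (H2_inner g f)"
    unfolding sums_cnj H2_inner_def by (intro summable_sums H2_inner_summable assms)
  then show ?thesis by (simp add: H2_inner_def sums_iff mult.commute)
qed

lemma H2_inner_add_right:
  assumes "f \<in> H2" "g \<in> H2" "k \<in> H2"
  shows "H2_inner k (\<lambda>z. f z + g z) = H2_inner k f + H2_inner k g"
  using assms by (simp add: H2_inner_commute[of k] H2_inner_add_left H2_add)

lemma H2_inner_cmult_right:
  assumes "f \<in> H2" "k \<in> H2"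
  shows "H2_inner k (\<lambda>z. c * f z) = cnj c * H2_inner k f"
  using assms by (simp add: H2_inner_commute[of k] H2_inner_cmult_left H2_cmult)

lemma H2_inner_self:
  assumes "f \<in> H2"
  shows "H2_inner f f = of_real ((H2_norm f)\<^sup>2)"
proof -
  have "(\<lambda>n. complex_of_real ((cmod (taylor_coeff f n))\<^sup>2)) sums of_real ((H2_norm f)\<^sup>2)"
    unfolding H2_norm_square[OF assms]
    by (intro sums_of_real summable_sums H2_summable assms)
  then show ?thesis
    by (simp add: H2_inner_def sums_iff complex_norm_square[symmetric] del: of_real_power)
qed

section \<open>Point evaluations and the Szego kernel\<close>

definition szego_kernel :: "complex \<Rightarrow> complex \<Rightarrow> complex" where
  "szego_kernel w z = (if z \<in> unit_disk then 1 / (1 - cnj w * z) else 0)"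

lemma szego_kernel:
  assumes "w \<in> unit_disk"
  shows szego_kernel_in_H2: "szego_kernel w \<in> H2"
    and szego_kernel_reproducing: "f \<in> H2 \<Longrightarrow> H2_inner f (szego_kernel w) = f w"
    and szego_kernel_norm: "(H2_norm (szego_kernel w))\<^sup>2 = 1 / (1 - (cmod w)\<^sup>2)"
proof -
  have s: "(\<lambda>n. cnj w ^ n * z ^ n) sums szego_kernel w z" if "z \<in> unit_disk" for z
  proof -
    have "cmod w * cmod z < 1 * 1"
      using assms that by (intro mult_strict_mono') auto
    then have "norm (cnj w * z) < 1" by (simp add: norm_mult)
    from geometric_sums[OF this] show ?thesis
      using that by (simp add: szego_kernel_def power_mult_distrib)
  qed
  have tc: "taylor_coeff (szego_kernel w) n = cnj w ^ n" for n
    by (rule taylor_coeff_eqI[OF s])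
  have *: "cnj w \<in> unit_disk" using assms by simp
  show in_H2: "szego_kernel w \<in> H2"
    by (rule H2I[OF s _ summable_square_geometric(1)[OF *]]) (auto simp: szego_kernel_def)
  show "H2_inner f (szego_kernel w) = f w" if "f \<in> H2"
    using H2_sums[OF that assms] by (simp add: H2_inner_def tc sums_iff)
  show "(H2_norm (szego_kernel w))\<^sup>2 = 1 / (1 - (cmod w)\<^sup>2)"
    using summable_square_geometric(2)[OF *] by (simp add: H2_norm_square in_H2 tc)
qed

text \<open>Cauchy-Schwarz against the kernel at \<open>w\<close>.\<close>

lemma H2_pointwise_bound:
  assumes "f \<in> H2" "w \<in> unit_disk"
  shows "cmod (f w) \<le> H2_norm f / sqrt (1 - (cmod w)\<^sup>2)"
proof -
  have "H2_norm (szego_kernel w) = sqrt (1 / (1 - (cmod w)\<^sup>2))"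
    using szego_kernel_norm[OF assms(2)] H2_norm_nonneg[OF szego_kernel_in_H2[OF assms(2)]]
    by (metis real_sqrt_unique)
  then show ?thesis
    using H2_inner_bound[OF assms(1) szego_kernel_in_H2[OF assms(2)]]
    using assms by (simp add: szego_kernel_reproducing real_sqrt_divide del: mem_ball_0 mem_ball)
qed

section \<open>Monomials and density of Taylor polynomials\<close>

definition H2_monom :: "nat \<Rightarrow> complex \<Rightarrow> complex" where
  "H2_monom n z = (if z \<in> unit_disk then z ^ n else 0)"

lemma H2_monom:
  shows taylor_coeff_H2_monom: "taylor_coeff (H2_monom n) m = (if m = n then 1 else 0)"
    and H2_monom_in_H2: "H2_monom n \<in> H2"
    and H2_inner_monom: "f \<in> H2 \<Longrightarrow> H2_inner f (H2_monom n) = taylor_coeff f n"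
proof -
  have s: "(\<lambda>m. (if m = n then 1 else 0) * z ^ m) sums H2_monom n z" if "z \<in> unit_disk" for z
  proof -
    have "(\<lambda>m. (if m = n then 1 else 0) * z ^ m) = (\<lambda>m. if m = n then z ^ m else 0)" by auto
    then show ?thesis using sums_single[of n "\<lambda>m. z ^ m"] that by (simp add: H2_monom_def)
  qed
  show tc: "taylor_coeff (H2_monom n) m = (if m = n then 1 else 0)" for m
    by (rule taylor_coeff_eqI[OF s])
  have "summable (\<lambda>m. (cmod (if m = n then 1 else 0))\<^sup>2)"
    by (rule summable_finite[of "{n}"]) auto
  then show "H2_monom n \<in> H2"
    by (rule H2I[OF s, rotated -1]) (auto simp: H2_monom_def)
  have "(\<lambda>m. taylor_coeff f m * cnj (if m = n then 1 else 0)) = (\<lambda>m. if m = n then taylor_coeff f m else 0)"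
    by auto
  then show "H2_inner f (H2_monom n) = taylor_coeff f n"
    using sums_single[of n "taylor_coeff f"] by (simp add: H2_inner_def tc sums_iff)
qed

lemma H2_inner_eqI:
  assumes "f \<in> H2" "g \<in> H2" "\<And>k. k \<in> H2 \<Longrightarrow> H2_inner k f = H2_inner k g"
  shows "f = g"
  by (rule H2_eqI[OF assms(1,2)])
    (metis H2_inner_monom H2_inner_commute H2_monom_in_H2 assms)

definition H2_partial :: "nat \<Rightarrow> (complex \<Rightarrow> complex) \<Rightarrow> complex \<Rightarrow> complex" where
  "H2_partial N f z = (\<Sum>n<N. taylor_coeff f n * H2_monom n z)"

lemma H2_finite_sum:
  assumes "\<And>n. n < (N::nat) \<Longrightarrow> f n \<in> H2"
  shows "(\<lambda>z. \<Sum>n<N. f n z) \<in> H2"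
    and "taylor_coeff (\<lambda>z. \<Sum>n<N. f n z) m = (\<Sum>n<N. taylor_coeff (f n) m)"
  using assms
proof (induction N)
  case (Suc N)
  { case 1 with Suc(1) show ?case by (simp add: H2_add) }
  { case 2 with Suc show ?case by (simp add: taylor_coeff_add H2_holomorphic) }
qed auto

lemma H2_partial:
  assumes "f \<in> H2"
  shows H2_partial_in_H2: "H2_partial N f \<in> H2"
    and taylor_coeff_partial: "taylor_coeff (H2_partial N f) m = (if m < N then taylor_coeff f m else 0)"
    and H2_norm_partial: "H2_norm (H2_partial N f) = L2_set (\<lambda>n. cmod (taylor_coeff f n)) {..<N}"
proof -
  have eq: "H2_partial N f = (\<lambda>z. \<Sum>n<N. taylor_coeff f n * H2_monom n z)"
    by (auto simp: H2_partial_def)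
  show in_H2: "H2_partial N f \<in> H2"
    unfolding eq by (intro H2_finite_sum H2_cmult H2_monom_in_H2)
  show tc: "taylor_coeff (H2_partial N f) m = (if m < N then taylor_coeff f m else 0)" for m
    unfolding eq
    by (subst H2_finite_sum(2))
      (auto simp: H2_cmult H2_monom_in_H2 taylor_coeff_cmult H2_holomorphic taylor_coeff_H2_monom
        if_distrib cong: if_cong)
  have "(\<Sum>n. (cmod (taylor_coeff (H2_partial N f) n))\<^sup>2) = (\<Sum>n<N. (cmod (taylor_coeff f n))\<^sup>2)"
    by (subst suminf_finite[of "{..<N}"]) (auto simp: tc)
  then show "H2_norm (H2_partial N f) = L2_set (\<lambda>n. cmod (taylor_coeff f n)) {..<N}"
    by (simp add: H2_norm_def L2_set_def)
qed

lemma H2_partial_tendsto: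
  assumes "f \<in> H2"
  shows "(\<lambda>N. H2_norm (\<lambda>z. f z - H2_partial N f z)) \<longlonglongrightarrow> 0"
proof -
  let ?x = "\<lambda>n. (cmod (taylor_coeff f n))\<^sup>2"
  have "H2_norm (\<lambda>z. f z - H2_partial N f z) = sqrt (suminf ?x - (\<Sum>n<N. ?x n))" for N
  proof -
    let ?g = "\<lambda>z. f z - H2_partial N f z"
    have g: "?g \<in> H2" by (intro H2_diff H2_partial_in_H2 assms)
    have tc: "taylor_coeff ?g n = (if n < N then 0 else taylor_coeff f n)" for n
      by (auto simp: taylor_coeff_diff H2_holomorphic assms H2_partial_in_H2 taylor_coeff_partial)
    have "(\<Sum>n. (cmod (taylor_coeff ?g n))\<^sup>2) = (\<Sum>n. ?x (n + N))"
      by (subst suminf_split_initial_segment[OF H2_summable[OF g], of N]) (simp add: tc)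
    then show ?thesis
      using suminf_minus_initial_segment[OF H2_summable[OF assms], of N] by (simp add: H2_norm_def)
  qed
  moreover have "(\<lambda>N. sqrt (suminf ?x - (\<Sum>n<N. ?x n))) \<longlonglongrightarrow> sqrt (suminf ?x - suminf ?x)"
    by (intro tendsto_intros summable_LIMSEQ H2_summable assms)
  ultimately show ?thesis by simp
qed


section \<open>Bounded operators and their adjoints\<close>

lemma bounded_operatorD:
  assumes "bounded_operator A"
  shows bounded_operator_H2: "f \<in> H2 \<Longrightarrow> A f \<in> H2"
    and bounded_operator_add: "f \<in> H2 \<Longrightarrow> g \<in> H2 \<Longrightarrow> A (\<lambda>z. f z + g z) = (\<lambda>z. A f z + A g z)"
    and bounded_operator_cmult: "f \<in> H2 \<Longrightarrow> A (\<lambda>z. k * f z) = (\<lambda>z. k * A f z)"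
  using assms by (auto simp: bounded_operator_def)

lemma bounded_operator_bound:
  assumes "bounded_operator A"
  obtains K where "K > 0" "\<And>f. f \<in> H2 \<Longrightarrow> H2_norm (A f) \<le> K * H2_norm f"
proof -
  obtain K where K: "\<And>f. f \<in> H2 \<Longrightarrow> H2_norm (A f) \<le> K * H2_norm f"
    using assms unfolding bounded_operator_def by blast
  have "H2_norm (A f) \<le> max K 1 * H2_norm f" if "f \<in> H2" for f
    by (rule order_trans[OF K[OF that] mult_right_mono]) (auto simp: H2_norm_nonneg that)
  then show thesis by (intro that[of "max K 1"]) auto
qed

lemma bounded_operator_comp:
  assumes "bounded_operator A" "bounded_operator B"
  shows "bounded_operator (\<lambda>f. A (B f))"
proof -
  obtain K where K: "K > 0" "\<And>f. f \<in> H2 \<Longrightarrow> H2_norm (A f) \<le> K * H2_norm f"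
    using bounded_operator_bound[OF assms(1)] by blast
  obtain L where L: "L > 0" "\<And>f. f \<in> H2 \<Longrightarrow> H2_norm (B f) \<le> L * H2_norm f"
    using bounded_operator_bound[OF assms(2)] by blast
  have "H2_norm (A (B f)) \<le> (K * L) * H2_norm f" if "f \<in> H2" for f
  proof -
    have "H2_norm (A (B f)) \<le> K * H2_norm (B f)"
      using K that bounded_operator_H2[OF assms(2)] by blast
    also have "\<dots> \<le> K * (L * H2_norm f)"
      using K(1) L(2)[OF that] by simp
    finally show ?thesis by (simp add: mult.assoc)
  qed
  then show ?thesis
    unfolding bounded_operator_def
    using bounded_operatorD[OF assms(1)] bounded_operatorD[OF assms(2)]
    by (auto intro!: exI[of _ "K * L"])
qed

text \<open>The coefficients of the representing vector are forced by the values of \<open>L\<close>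
  on monomials. Boundedness of \<open>L\<close> makes them square-summable, and density of Taylor
  polynomials gives the formula everywhere.\<close>

lemma H2_riesz:
  assumes add: "\<And>f g. f \<in> H2 \<Longrightarrow> g \<in> H2 \<Longrightarrow> L (\<lambda>z. f z + g z) = L f + L g"
    and cmult: "\<And>f k. f \<in> H2 \<Longrightarrow> L (\<lambda>z. k * f z) = k * L f"
    and bound: "\<And>f. f \<in> H2 \<Longrightarrow> cmod (L f) \<le> K * H2_norm f"
  obtains g where "g \<in> H2" "\<And>f. f \<in> H2 \<Longrightarrow> L f = H2_inner f g"
proof -
  define b where "b n = cnj (L (H2_monom n))" for n
  have zero: "L (\<lambda>z. 0) = 0" using cmult[of "\<lambda>z. 0" 0] by simp
  have partial: "L (H2_partial N f) = (\<Sum>n<N. taylor_coeff f n * cnj (b n))" for N f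
  proof (induction N)
    case 0
    then show ?case using zero by (simp add: H2_partial_def)
  next
    case (Suc N)
    have eq: "H2_partial (Suc N) f = (\<lambda>z. H2_partial N f z + taylor_coeff f N * H2_monom N z)"
      by (auto simp: H2_partial_def)
    have "H2_partial N f \<in> H2"
      unfolding H2_partial_def by (intro H2_finite_sum H2_cmult H2_monom_in_H2)
    then show ?case
      by (simp add: eq add cmult H2_cmult H2_monom_in_H2 Suc b_def)
  qed
  \<comment> \<open>The monomial of degree 0 has norm 1, so \<open>bound\<close> there forces the
    sign of \<open>K\<close>.\<close>
  have K: "0 \<le> K"
  proof -
    have "(H2_norm (H2_monom 0))\<^sup>2 = 1"
      using H2_inner_self[OF H2_monom_in_H2[of 0]] H2_inner_monom[OF H2_monom_in_H2[of 0], of 0]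
      by (simp add: taylor_coeff_H2_monom del: of_real_power)
    then have "H2_norm (H2_monom 0) > 0" using H2_norm_nonneg[OF H2_monom_in_H2[of 0]]
      by (cases "H2_norm (H2_monom 0) = 0") auto
    then show ?thesis using bound[OF H2_monom_in_H2[of 0]] norm_ge_zero[of "L (H2_monom 0)"]
      by (meson order_trans zero_le_mult_iff not_less)
  qed
  \<comment> \<open>The polynomial \<open>p\<close> with coefficients \<open>b n\<close> satisfies
    \<open>L p = ?s * ?s\<close> and has norm \<open>?s\<close>; cancelling \<open>?s\<close> in
    \<open>bound\<close> leaves \<open>K\<close>, whatever \<open>N\<close> is.\<close>
  have bb: "L2_set (\<lambda>n. cmod (b n)) {..<N} \<le> K" for N
  proof -
    let ?s = "L2_set (\<lambda>n. cmod (b n)) {..<N}"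
    define p where "p = (\<lambda>z. \<Sum>n<N. b n * H2_monom n z)"
    have pH2: "p \<in> H2" unfolding p_def by (intro H2_finite_sum H2_cmult H2_monom_in_H2)
    have tc: "taylor_coeff p m = (if m < N then b m else 0)" for m
      unfolding p_def
      by (subst H2_finite_sum(2))
        (auto simp: H2_cmult H2_monom_in_H2 taylor_coeff_cmult H2_holomorphic taylor_coeff_H2_monom
          if_distrib cong: if_cong)
    have pp: "H2_partial N p = p"
      by (rule H2_eqI[OF H2_partial_in_H2[OF pH2] pH2])
        (simp add: taylor_coeff_partial pH2 tc)
    have np: "H2_norm p = ?s"
      unfolding H2_norm_partial[OF pH2, of N, unfolded pp]
      by (rule L2_set_cong) (auto simp: tc)
    have "L p = (\<Sum>n<N. taylor_coeff p n * cnj (b n))"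
      using partial[of N p] by (simp add: pp)
    also have "\<dots> = (\<Sum>n<N. of_real ((cmod (b n))\<^sup>2))"
      by (rule sum.cong) (auto simp: tc complex_norm_square simp del: of_real_power)
    also have "\<dots> = of_real (?s\<^sup>2)"
      by (simp add: L2_set_def sum_nonneg del: of_real_power)
    finally have "cmod (L p) = ?s\<^sup>2" by (simp del: of_real_power)
    then have "?s * ?s \<le> K * ?s" using bound[OF pH2] np by (simp add: power2_eq_square)
    then show ?thesis
      using K L2_set_nonneg[of "\<lambda>n. cmod (b n)" "{..<N}"]
      by (cases "?s = 0") (auto simp: mult_le_cancel_right)
  qed
  note b2 = summable_square_boundedI(1)[OF bb]
  show thesis
  proof (rule that[of "H2_series b"])
    show gH2: "H2_series b \<in> H2" by (rule H2_series_in_H2[OF b2])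
    fix f assume f: "f \<in> H2"
    have "(\<lambda>N. L (H2_partial N f)) \<longlonglongrightarrow> H2_inner f (H2_series b)"
      using summable_LIMSEQ[OF H2_inner_summable[OF f gH2]]
      by (simp add: partial H2_inner_def taylor_coeff_H2_series[OF b2])
    \<comment> \<open>By \<open>bound\<close>, \<open>L\<close> is continuous, hence determined by
      its values on Taylor polynomials.\<close>
    moreover have "(\<lambda>N. L (H2_partial N f)) \<longlonglongrightarrow> L f"
    proof (rule LIM_zero_cancel, rule Lim_null_comparison)
      show "(\<lambda>N. K * H2_norm (\<lambda>z. f z - H2_partial N f z)) \<longlonglongrightarrow> 0"
        using tendsto_mult[OF tendsto_const H2_partial_tendsto[OF f], of K] by simp
      have "norm (L (H2_partial N f) - L f) \<le> K * H2_norm (\<lambda>z. f z - H2_partial N f z)" for N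
      proof -
        have d: "(\<lambda>z. f z - H2_partial N f z) \<in> H2"
          by (intro H2_diff H2_partial_in_H2 f)
        have "L f = L (\<lambda>z. (f z - H2_partial N f z) + H2_partial N f z)" by simp
        also have "\<dots> = L (\<lambda>z. f z - H2_partial N f z) + L (H2_partial N f)"
          by (rule add[OF d H2_partial_in_H2[OF f]])
        finally show ?thesis using bound[OF d] by (simp add: norm_minus_commute)
      qed
      then show "\<forall>\<^sub>F N in sequentially. norm (L (H2_partial N f) - L f)
          \<le> K * H2_norm (\<lambda>z. f z - H2_partial N f z)" by simp
    qed
    ultimately show "L f = H2_inner f (H2_series b)" by (rule LIMSEQ_unique[rotated])
  qed
qed

text \<open>Riesz for the functional \<open>k \<mapsto> H2_inner (A k) f\<close>; uniqueness of the
  representing vector justifies the \<open>THE\<close> in the definition.\<close>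

lemma adjoint_operator:
  assumes "bounded_operator A" "f \<in> H2"
  shows adjoint_operator_H2: "adjoint_operator A f \<in> H2"
    and adjoint_operator_inner: "k \<in> H2 \<Longrightarrow> H2_inner (A k) f = H2_inner k (adjoint_operator A f)"
proof -
  obtain K where K: "K > 0" "\<And>f. f \<in> H2 \<Longrightarrow> H2_norm (A f) \<le> K * H2_norm f"
    using bounded_operator_bound[OF assms(1)] by blast
  note A = bounded_operatorD[OF assms(1)]
  obtain g where g: "g \<in> H2" "\<And>k. k \<in> H2 \<Longrightarrow> H2_inner (A k) f = H2_inner k g"
  proof (rule H2_riesz[of "\<lambda>k. H2_inner (A k) f" "K * H2_norm f"])
    fix k assume k: "k \<in> H2"
    have "cmod (H2_inner (A k) f) \<le> H2_norm (A k) * H2_norm f"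
      by (intro H2_inner_bound A k assms)
    also have "\<dots> \<le> (K * H2_norm k) * H2_norm f"
      by (intro mult_right_mono K k H2_norm_nonneg assms)
    finally show "cmod (H2_inner (A k) f) \<le> K * H2_norm f * H2_norm k"
      by (simp add: mult_ac)
  qed (auto simp: A H2_inner_add_left H2_inner_cmult_left assms(2))
  have "adjoint_operator A f = g"
    unfolding adjoint_operator_def
    by (rule the_equality) (use g in \<open>auto intro: H2_inner_eqI\<close>)
  with g show "adjoint_operator A f \<in> H2"
    and "k \<in> H2 \<Longrightarrow> H2_inner (A k) f = H2_inner k (adjoint_operator A f)" by auto
qed

lemma adjoint_operator_eqI:
  assumes "bounded_operator A" "f \<in> H2" "g \<in> H2"
    and "\<And>k. k \<in> H2 \<Longrightarrow> H2_inner (A k) f = H2_inner k g"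
  shows "adjoint_operator A f = g"
  by (rule H2_inner_eqI[OF adjoint_operator_H2[OF assms(1,2)] assms(3)])
    (metis adjoint_operator_inner assms)

lemma adjoint_operator_inner':
  assumes "bounded_operator A" "f \<in> H2" "k \<in> H2"
  shows "H2_inner (adjoint_operator A f) k = H2_inner f (A k)"
  using adjoint_operator_inner[OF assms] H2_inner_commute bounded_operator_H2[OF assms(1)]
    adjoint_operator_H2[OF assms(1)] assms by metis

lemma H2_norm_le_mult_cancel:
  assumes "f \<in> H2" "(H2_norm f)\<^sup>2 \<le> C * H2_norm f" "0 \<le> C"
  shows "H2_norm f \<le> C"
  using assms H2_norm_nonneg[OF assms(1)]
  by (cases "H2_norm f = 0") (auto simp: power2_eq_square mult_le_cancel_right)

text \<open>\<open>\<parallel>A\<^sup>* f\<parallel>\<^sup>2 = \<langle>A A\<^sup>* f, f\<rangle>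
  \<le> K \<parallel>A\<^sup>* f\<parallel> \<parallel>f\<parallel>\<close>, and one factor
  cancels.\<close>

lemma bounded_operator_adjoint:
  assumes "bounded_operator A"
  shows "bounded_operator (adjoint_operator A)"
proof -
  obtain K where K: "K > 0" "\<And>f. f \<in> H2 \<Longrightarrow> H2_norm (A f) \<le> K * H2_norm f"
    using bounded_operator_bound[OF assms(1)] by blast
  note A = bounded_operatorD[OF assms(1)] and adj = adjoint_operator[OF assms(1)]
  have "H2_norm (adjoint_operator A f) \<le> K * H2_norm f" if f: "f \<in> H2" for f
  proof (rule H2_norm_le_mult_cancel)
    let ?g = "adjoint_operator A f"
    show g: "?g \<in> H2" by (rule adj[OF f])
    have "(H2_norm ?g)\<^sup>2 = cmod (H2_inner ?g ?g)"
      by (simp add: H2_inner_self g del: of_real_power)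
    also have "\<dots> = cmod (H2_inner (A ?g) f)" using adj(2)[OF f g] by simp
    also have "\<dots> \<le> H2_norm (A ?g) * H2_norm f" by (intro H2_inner_bound A g f)
    also have "\<dots> \<le> K * H2_norm ?g * H2_norm f"
      by (intro mult_right_mono K g f H2_norm_nonneg)
    finally show "(H2_norm ?g)\<^sup>2 \<le> K * H2_norm f * H2_norm ?g" by (simp add: mult_ac)
    show "0 \<le> K * H2_norm f" using K f by (simp add: H2_norm_nonneg)
  qed
  moreover have "adjoint_operator A (\<lambda>z. f z + g z) = (\<lambda>z. adjoint_operator A f z + adjoint_operator A g z)"
    if "f \<in> H2" "g \<in> H2" for f g
    by (rule adjoint_operator_eqI[OF assms])
      (auto simp: that H2_add adj H2_inner_add_right A)
  moreover have "adjoint_operator A (\<lambda>z. k * f z) = (\<lambda>z. k * adjoint_operator A f z)"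
    if "f \<in> H2" for f k
    by (rule adjoint_operator_eqI[OF assms])
      (auto simp: that H2_cmult adj H2_inner_cmult_right A)
  ultimately show ?thesis
    unfolding bounded_operator_def using adj(1) by blast
qed

section \<open>Positive operators and range factorization\<close>

lemma H2_inner_expand:
  assumes "bounded_operator P" "f \<in> H2" "g \<in> H2"
  shows "H2_inner (P (\<lambda>z. f z + k * g z)) (\<lambda>z. f z + k * g z) =
    H2_inner (P f) f + cnj k * H2_inner (P f) g + k * H2_inner (P g) f + k * cnj k * H2_inner (P g) g"
  using bounded_operatorD[OF assms(1)] assms(2,3)
  by (simp add: H2_cmult H2_add H2_inner_add_left H2_inner_add_right
      H2_inner_cmult_left H2_inner_cmult_right algebra_simps)

text \<open>Polarization: reality of the form at \<open>f + g\<close> compares the imaginary parts,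
  reality at \<open>f + \<i> g\<close> the real parts.\<close>

lemma positive_operator_self_adjoint:
  assumes "positive_operator P" "f \<in> H2" "g \<in> H2"
  shows "H2_inner (P f) g = cnj (H2_inner (P g) f)"
proof -
  have P: "bounded_operator P" and real: "\<And>f. f \<in> H2 \<Longrightarrow> Im (H2_inner (P f) f) = 0"
    using assms(1) by (auto simp: positive_operator_def complex_is_Real_iff)
  note PD = bounded_operatorD[OF P]
  note expand = H2_inner_expand[OF P assms(2,3)]
  have 1: "Im (H2_inner (P f) g) + Im (H2_inner (P g) f) = 0"
    using arg_cong[OF expand[of 1], of Im] real[of f] real[of g] assms
      real[of "\<lambda>z. f z + 1 * g z"] by (simp add: H2_add)
  have 2: "Re (H2_inner (P g) f) - Re (H2_inner (P f) g) = 0"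
    using arg_cong[OF expand[of \<i>], of Im] real[of f] real[of g] assms
      real[of "\<lambda>z. f z + \<i> * g z"] by (simp add: H2_add H2_cmult)
  show ?thesis using 1 2 by (simp add: complex_eq_iff)
qed

text \<open>Positivity at \<open>f - t P f\<close> with \<open>t = 1 / K\<close> does the work of a
  square root of \<open>P\<close>: the quadratic term is at most
  \<open>t \<parallel>P f\<parallel>\<^sup>2\<close>, half of what the linear term
  subtracts.\<close>

lemma positive_operator_bound:
  assumes "positive_operator P"
  obtains K where "K > 0"
    "\<And>f. f \<in> H2 \<Longrightarrow> (H2_norm (P f))\<^sup>2 \<le> K * Re (H2_inner (P f) f)"
proof -
  have P: "bounded_operator P" and pos: "\<And>f. f \<in> H2 \<Longrightarrow> 0 \<le> Re (H2_inner (P f) f)"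
    using assms(1) by (auto simp: positive_operator_def)
  note PD = bounded_operatorD[OF P]
  obtain K where K: "K > 0" "\<And>f. f \<in> H2 \<Longrightarrow> H2_norm (P f) \<le> K * H2_norm f"
    using bounded_operator_bound[OF P] by blast
  have "(H2_norm (P f))\<^sup>2 \<le> K * Re (H2_inner (P f) f)" if f: "f \<in> H2" for f
  proof -
    let ?g = "P f"
    define t where "t = 1 / K"
    have g: "?g \<in> H2" using PD f by blast
    have gf: "H2_inner (P ?g) f = of_real ((H2_norm ?g)\<^sup>2)"
      using positive_operator_self_adjoint[OF assms g f] by (simp add: H2_inner_self g)
    have "H2_inner (P (\<lambda>z. f z + of_real (- t) * ?g z)) (\<lambda>z. f z + of_real (- t) * ?g z) =
      H2_inner (P f) f - 2 * of_real t * of_real ((H2_norm ?g)\<^sup>2) + (of_real t)\<^sup>2 * H2_inner (P ?g) ?g"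
      unfolding H2_inner_expand[OF P f g] gf
      by (simp add: H2_inner_self g power2_eq_square algebra_simps)
    from arg_cong[OF this, of Re] have
      "0 \<le> Re (H2_inner (P f) f) - 2 * t * (H2_norm ?g)\<^sup>2 + t\<^sup>2 * Re (H2_inner (P ?g) ?g)"
      using pos[of "\<lambda>z. f z + of_real (- t) * ?g z"] f g
      by (simp add: H2_add H2_cmult H2_diff flip: of_real_power of_real_mult)
    moreover have "Re (H2_inner (P ?g) ?g) \<le> K * (H2_norm ?g)\<^sup>2"
    proof -
      have "Re (H2_inner (P ?g) ?g) \<le> H2_norm (P ?g) * H2_norm ?g"
        using H2_inner_bound[of "P ?g" ?g] complex_Re_le_cmod[of "H2_inner (P ?g) ?g"] g PD by force
      also have "\<dots> \<le> (K * H2_norm ?g) * H2_norm ?g"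
        by (intro mult_right_mono K g H2_norm_nonneg)
      finally show ?thesis by (simp add: power2_eq_square mult.assoc)
    qed
    then have "t\<^sup>2 * Re (H2_inner (P ?g) ?g) \<le> t\<^sup>2 * (K * (H2_norm ?g)\<^sup>2)"
      by (intro mult_left_mono) auto
    then have "t\<^sup>2 * Re (H2_inner (P ?g) ?g) \<le> t * (H2_norm ?g)\<^sup>2"
      using K(1) by (simp add: t_def power2_eq_square)
    ultimately have "t * (H2_norm ?g)\<^sup>2 \<le> Re (H2_inner (P f) f)" by simp
    then show ?thesis using K(1) by (simp add: t_def field_simps)
  qed
  with K(1) that show thesis by blast
qed

text \<open>A posinormal \<open>A\<close> satisfies Douglas' range inclusion with a norm bound:
  \<open>\<parallel>P A f\<parallel>\<^sup>2 \<le> K \<langle>P A f, A f\<rangle> = K \<langle>A A\<^sup>* f, f\<rangle> = K \<parallel>A\<^sup>* f\<parallel>\<^sup>2\<close>.\<close>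

lemma posinormal_factor:
  assumes "posinormal A"
  obtains K where "K > 0"
    "\<And>f. f \<in> H2 \<Longrightarrow> \<exists>u\<in>H2. A (adjoint_operator A f) = adjoint_operator A u \<and>
        (H2_norm u)\<^sup>2 \<le> K * (H2_norm (adjoint_operator A f))\<^sup>2"
proof -
  obtain P where A: "bounded_operator A" and P: "positive_operator P"
    and eq: "\<And>f. f \<in> H2 \<Longrightarrow> A (adjoint_operator A f) = adjoint_operator A (P (A f))"
    using assms by (auto simp: posinormal_def)
  have PB: "bounded_operator P" using P by (simp add: positive_operator_def)
  note AD = bounded_operatorD[OF A] and PD = bounded_operatorD[OF PB] and adj = adjoint_operator[OF A]
  obtain K where K: "K > 0" "\<And>f. f \<in> H2 \<Longrightarrow> (H2_norm (P f))\<^sup>2 \<le> K * Re (H2_inner (P f) f)"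
    using positive_operator_bound[OF P] by blast
  show thesis
  proof (rule that[OF K(1)])
    fix f assume f: "f \<in> H2"
    have "H2_inner (P (A f)) (A f) = H2_inner (adjoint_operator A (P (A f))) f"
      by (simp add: adjoint_operator_inner'[OF A] AD PD f)
    also have "\<dots> = H2_inner (A (adjoint_operator A f)) f" by (simp add: eq f)
    also have "\<dots> = of_real ((H2_norm (adjoint_operator A f))\<^sup>2)"
      by (simp add: adj f H2_inner_self)
    finally have "Re (H2_inner (P (A f)) (A f)) = (H2_norm (adjoint_operator A f))\<^sup>2" by simp
    then show "\<exists>u\<in>H2. A (adjoint_operator A f) = adjoint_operator A u \<and>
        (H2_norm u)\<^sup>2 \<le> K * (H2_norm (adjoint_operator A f))\<^sup>2"
      using K(2)[of "A f"] eq[OF f] AD PD f by (intro bexI[of _ "P (A f)"]) auto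
  qed
qed

lemma posinormalI_factor:
  assumes A: "bounded_operator A" and X: "bounded_operator X"
    and eq: "\<And>f. f \<in> H2 \<Longrightarrow> A f = adjoint_operator A (X f)"
  shows "posinormal A"
proof -
  let ?P = "\<lambda>f. X (adjoint_operator X f)"
  note AD = bounded_operatorD[OF A] and XD = bounded_operatorD[OF X]
    and adjA = adjoint_operator[OF A] and adjX = adjoint_operator[OF X]
  have P: "bounded_operator ?P"
    by (rule bounded_operator_comp[OF X bounded_operator_adjoint[OF X]])
  have "positive_operator ?P"
    unfolding positive_operator_def
    using P by (auto simp: adjX H2_inner_self simp del: of_real_power)
  moreover have "A (adjoint_operator A f) = adjoint_operator A (?P (A f))" if f: "f \<in> H2" for f
  proof -
    have "adjoint_operator A f = adjoint_operator X (A f)"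
    proof (rule adjoint_operator_eqI[OF A f])
      show "adjoint_operator X (A f) \<in> H2" by (intro adjX AD f)
      fix k assume k: "k \<in> H2"
      have "H2_inner (A k) f = H2_inner (X k) (A f)"
        unfolding eq[OF k] by (rule adjoint_operator_inner'[OF A XD(1)[OF k] f])
      then show "H2_inner (A k) f = H2_inner k (adjoint_operator X (A f))"
        using adjX(2)[OF AD(1)[OF f] k] by simp
    qed
    then show ?thesis using eq[of "adjoint_operator A f"] adjA(1)[OF f] by simp
  qed
  ultimately show ?thesis unfolding posinormal_def using A by blast
qed


section \<open>Multipliers\<close>

lemma taylor_coeff_shift:
  assumes "f holomorphic_on unit_disk"
  shows "taylor_coeff (\<lambda>z. z * f z) n = (case n of 0 \<Rightarrow> 0 | Suc m \<Rightarrow> taylor_coeff f m)"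
proof (rule taylor_coeff_eqI)
  fix z :: complex assume "z \<in> unit_disk"
  from sums_mult[OF taylor_coeff_sums[OF assms this], of z]
  have "(\<lambda>n. (case Suc n of 0 \<Rightarrow> 0 | Suc m \<Rightarrow> taylor_coeff f m) * z ^ Suc n) sums (z * f z)"
    by (simp add: mult_ac)
  then show "(\<lambda>n. (case n of 0 \<Rightarrow> 0 | Suc m \<Rightarrow> taylor_coeff f m) * z ^ n) sums (z * f z)"
    by (subst (asm) sums_Suc_iff) simp
qed

text \<open>The shift pushes one coefficient out of the section, hence only an inequality.\<close>

lemma L2_set_shift_le:
  fixes a :: "nat \<Rightarrow> complex"
  shows "L2_set (\<lambda>n. cmod (case n of 0 \<Rightarrow> 0 | Suc m \<Rightarrow> a m)) {..<N} \<le> L2_set (\<lambda>n. cmod (a n)) {..<N}"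
proof (cases N)
  case (Suc M)
  have "(\<Sum>n<Suc M. (cmod (case n of 0 \<Rightarrow> 0 | Suc m \<Rightarrow> a m))\<^sup>2) = (\<Sum>n<M. (cmod (a n))\<^sup>2)"
    by (simp only: sum.lessThan_Suc_shift) simp
  then show ?thesis
    unfolding L2_set_def Suc by simp
qed simp

lemma H2_shift:
  assumes "f \<in> H2"
  shows "(\<lambda>z. z * f z) \<in> H2" "H2_norm (\<lambda>z. z * f z) = H2_norm f"
proof -
  have tc: "taylor_coeff (\<lambda>z. z * f z) n = (case n of 0 \<Rightarrow> 0 | Suc m \<Rightarrow> taylor_coeff f m)" for n
    by (rule taylor_coeff_shift) (rule H2_holomorphic[OF assms])
  have s: "summable (\<lambda>n. (cmod (taylor_coeff (\<lambda>z. z * f z) n))\<^sup>2)"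
    using H2_summable[OF assms] by (subst summable_Suc_iff[symmetric]) (simp add: tc)
  then show "(\<lambda>z. z * f z) \<in> H2"
    using H2_holomorphic[OF assms] H2_outside[OF assms] by (auto simp: H2_def intro!: holomorphic_intros)
  show "H2_norm (\<lambda>z. z * f z) = H2_norm f"
    unfolding H2_norm_def by (subst suminf_split_head[OF s, symmetric, simplified tc, simplified, symmetric])
      (simp add: tc)
qed

lemma multiplication_linear_H2:
  assumes "f \<in> H2"
  shows "(\<lambda>z. (\<alpha> * z + \<beta>) * f z) \<in> H2"
    and "H2_norm (\<lambda>z. (\<alpha> * z + \<beta>) * f z) \<le> (cmod \<alpha> + cmod \<beta>) * H2_norm f"
proof -
  have eq: "(\<lambda>z. (\<alpha> * z + \<beta>) * f z) = (\<lambda>z. \<alpha> * (z * f z) + \<beta> * f z)"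
    by (simp add: algebra_simps)
  show "(\<lambda>z. (\<alpha> * z + \<beta>) * f z) \<in> H2"
    unfolding eq by (intro H2_add H2_cmult H2_shift assms)
  have "H2_norm (\<lambda>z. \<alpha> * (z * f z) + \<beta> * f z) \<le> H2_norm (\<lambda>z. \<alpha> * (z * f z)) + H2_norm (\<lambda>z. \<beta> * f z)"
    by (intro H2_add H2_cmult H2_shift assms)
  then show "H2_norm (\<lambda>z. (\<alpha> * z + \<beta>) * f z) \<le> (cmod \<alpha> + cmod \<beta>) * H2_norm f"
    unfolding eq by (simp add: H2_cmult H2_shift assms distrib_right)
qed

lemma H2_norm_add_square:
  assumes "f \<in> H2" "g \<in> H2"
  shows "(H2_norm (\<lambda>z. f z + k * g z))\<^sup>2 =
    (H2_norm f)\<^sup>2 + 2 * Re (k * H2_inner g f) + (cmod k)\<^sup>2 * (H2_norm g)\<^sup>2"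
proof -
  have "bounded_operator (\<lambda>f. f)" by (auto simp: bounded_operator_def intro!: exI[of _ 1])
  from arg_cong[OF H2_inner_expand[OF this assms, of k], of Re]
  show ?thesis
    using assms H2_inner_commute[OF assms]
    by (simp add: H2_inner_self H2_add H2_cmult complex_mult_cnj cmod_power2 flip: of_real_power)
qed

text \<open>The shift is isometric, so both square terms are multiples of the norm of
  \<open>f\<close> and only the cross term involves more.\<close>

lemma H2_norm_linear_square:
  assumes "f \<in> H2"
  shows "(H2_norm (\<lambda>z. (\<alpha> * z + \<beta>) * f z))\<^sup>2 =
    ((cmod \<alpha>)\<^sup>2 + (cmod \<beta>)\<^sup>2) * (H2_norm f)\<^sup>2 + 2 * Re (\<alpha> * cnj \<beta> * H2_inner (\<lambda>z. z * f z) f)"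
proof -
  have eq: "(\<lambda>z. (\<alpha> * z + \<beta>) * f z) = (\<lambda>z. \<beta> * f z + \<alpha> * (z * f z))"
    by (simp add: algebra_simps)
  show ?thesis
    unfolding eq
    by (subst H2_norm_add_square)
      (simp_all add: assms H2_cmult H2_shift H2_inner_cmult_right power_mult_distrib algebra_simps)
qed

lemma linear_nonzero_disk:
  fixes \<gamma> \<delta> z :: complex
  assumes "cmod \<gamma> < cmod \<delta>" "cmod z \<le> 1"
  shows "\<gamma> * z + \<delta> \<noteq> 0"
proof
  assume "\<gamma> * z + \<delta> = 0"
  then have "cmod \<delta> = cmod \<gamma> * cmod z"
    by (metis add_eq_0_iff norm_minus_cancel norm_mult)
  moreover have "cmod \<gamma> * cmod z \<le> cmod \<gamma> * 1" by (intro mult_left_mono assms) simp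
  ultimately show False using assms by simp
qed

text \<open>The coefficients \<open>e n\<close> of the quotient satisfy
  \<open>\<delta> * e n = f n - \<gamma> * e (n - 1)\<close>. A section of length \<open>N\<close>
  with norm \<open>L\<close> thus obeys
  \<open>cmod \<delta> * L \<le> H2_norm f + cmod \<gamma> * L\<close>, which can be solved for
  \<open>L\<close> because \<open>L\<close> is finite; membership is a conclusion.\<close>

lemma division_linear_H2:
  assumes "f \<in> H2" "cmod \<gamma> < cmod \<delta>"
  shows "(\<lambda>z. f z / (\<gamma> * z + \<delta>)) \<in> H2"
    and "H2_norm (\<lambda>z. f z / (\<gamma> * z + \<delta>)) \<le> H2_norm f / (cmod \<delta> - cmod \<gamma>)"
proof -
  let ?e = "\<lambda>z. f z / (\<gamma> * z + \<delta>)"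
  have hol: "?e holomorphic_on unit_disk"
    using linear_nonzero_disk[OF assms(2)] H2_holomorphic[OF assms(1)]
    by (auto intro!: holomorphic_intros)
  note hol2 = holomorphic_on_mult[OF holomorphic_on_ident hol]
  let ?s = "\<lambda>n. case n of 0 \<Rightarrow> 0 | Suc m \<Rightarrow> taylor_coeff ?e m"
  have rec: "\<delta> * taylor_coeff ?e n = taylor_coeff f n + (- \<gamma>) * ?s n" for n
  proof -
    have "taylor_coeff f n = taylor_coeff (\<lambda>z. \<gamma> * (z * ?e z) + \<delta> * ?e z) n"
    proof (rule taylor_coeff_eqI)
      fix z :: complex assume z: "z \<in> unit_disk"
      have "\<gamma> * z + \<delta> \<noteq> 0" using linear_nonzero_disk[OF assms(2)] z by simp
      then have "f z = \<gamma> * (z * ?e z) + \<delta> * ?e z" by (simp add: divide_simps) (simp add: algebra_simps)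
      then show "(\<lambda>n. taylor_coeff (\<lambda>z. \<gamma> * (z * ?e z) + \<delta> * ?e z) n * z ^ n) sums f z"
        using taylor_coeff_sums[of "\<lambda>z. \<gamma> * (z * ?e z) + \<delta> * ?e z", OF _ z]
          holomorphic_on_add[OF holomorphic_on_mult[OF holomorphic_on_const hol2]
            holomorphic_on_mult[OF holomorphic_on_const hol]]
        by metis
    qed
    also have "\<dots> = \<gamma> * ?s n + \<delta> * taylor_coeff ?e n"
      by (subst taylor_coeff_add[OF holomorphic_on_mult[OF holomorphic_on_const hol2]
            holomorphic_on_mult[OF holomorphic_on_const hol]])
        (simp only: taylor_coeff_cmult[OF hol] taylor_coeff_cmult[OF hol2] taylor_coeff_shift[OF hol])
    finally show ?thesis by simp
  qed
  have bd: "L2_set (\<lambda>n. cmod (taylor_coeff ?e n)) {..<N} \<le> H2_norm f / (cmod \<delta> - cmod \<gamma>)" for N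
  proof -
    let ?L = "L2_set (\<lambda>n. cmod (taylor_coeff ?e n)) {..<N}"
    have "cmod \<delta> * ?L = L2_set (\<lambda>n. cmod (taylor_coeff f n + (- \<gamma>) * ?s n)) {..<N}"
      unfolding rec[symmetric] norm_mult by (rule L2_set_right_distrib) simp
    also have "\<dots> \<le> L2_set (\<lambda>n. cmod (taylor_coeff f n)) {..<N} + L2_set (\<lambda>n. cmod ((- \<gamma>) * ?s n)) {..<N}"
      by (rule L2_set_cmod_add)
    also have "L2_set (\<lambda>n. cmod ((- \<gamma>) * ?s n)) {..<N} = cmod \<gamma> * L2_set (\<lambda>n. cmod (?s n)) {..<N}"
      unfolding norm_mult by (subst L2_set_right_distrib) auto
    also have "L2_set (\<lambda>n. cmod (taylor_coeff f n)) {..<N} + \<dots> \<le> H2_norm f + cmod \<gamma> * ?L"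
      by (intro add_mono mult_left_mono L2_set_shift_le L2_set_le_H2_norm assms) simp
    finally show ?thesis using assms(2) by (simp add: field_simps)
  qed
  note * = summable_square_boundedI[OF bd]
  show "?e \<in> H2"
    using hol *(1) H2_outside[OF assms(1)] by (auto simp: H2_def)
  show "H2_norm ?e \<le> H2_norm f / (cmod \<delta> - cmod \<gamma>)"
    unfolding H2_norm_def using *(2) by (simp add: H2_norm_def)
qed

lemma bounded_operator_multiplicationI:
  assumes "\<And>f. f \<in> H2 \<Longrightarrow> (\<lambda>z. \<psi> z * f z) \<in> H2"
    and "\<And>f. f \<in> H2 \<Longrightarrow> H2_norm (\<lambda>z. \<psi> z * f z) \<le> K * H2_norm f"
  shows "bounded_operator (multiplication_operator \<psi>)"
  using assms unfolding bounded_operator_def multiplication_operator_def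
  by (auto simp: algebra_simps)

lemma bounded_operator_linear:
  "bounded_operator (multiplication_operator (\<lambda>z. \<alpha> * z + \<beta>))"
  by (rule bounded_operator_multiplicationI[OF multiplication_linear_H2])

lemma bounded_operator_inverse_linear:
  assumes "cmod \<gamma> < cmod \<delta>"
  shows "bounded_operator (multiplication_operator (\<lambda>z. k / (\<gamma> * z + \<delta>)))"
proof (rule bounded_operator_multiplicationI)
  fix f assume f: "f \<in> H2"
  have eq: "(\<lambda>z. k / (\<gamma> * z + \<delta>) * f z) = (\<lambda>z. k * (f z / (\<gamma> * z + \<delta>)))" by simp
  show "(\<lambda>z. k / (\<gamma> * z + \<delta>) * f z) \<in> H2"
    unfolding eq by (intro H2_cmult division_linear_H2 f assms)
  show "H2_norm (\<lambda>z. k / (\<gamma> * z + \<delta>) * f z) \<le> (cmod k / (cmod \<delta> - cmod \<gamma>)) * H2_norm f"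
    unfolding eq H2_cmult(2)[OF division_linear_H2(1)[OF f assms]]
    using mult_left_mono[OF division_linear_H2(2)[OF f assms], of "cmod k"] by simp
qed

section \<open>Linear-fractional multipliers bounded by 1\<close>

lemma closed_disk_bound:
  fixes a b c d :: complex
  assumes "\<And>z. z \<in> unit_disk \<Longrightarrow> cmod (a * z + b) \<le> cmod (c * z + d)" "cmod z \<le> 1"
  shows "cmod (a * z + b) \<le> cmod (c * z + d)"
proof -
  have "closed {z. cmod (a * z + b) \<le> cmod (c * z + d)}"
    by (intro closed_Collect_le continuous_intros)
  then have "closure unit_disk \<subseteq> {z. cmod (a * z + b) \<le> cmod (c * z + d)}"
    using assms(1) by (intro closure_minimal) auto
  then show ?thesis using assms(2) by auto
qed

lemma cmod_add_squared:
  "(cmod (x + y))\<^sup>2 = (cmod x)\<^sup>2 + (cmod y)\<^sup>2 + 2 * Re (x * cnj y)"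
  unfolding cmod_power2 by (simp add: power2_eq_square algebra_simps)

lemma cmod_linear_square:
  fixes a b u :: complex
  assumes "cmod u = 1"
  shows "(cmod (a * u + b))\<^sup>2 = (cmod a)\<^sup>2 + (cmod b)\<^sup>2 + 2 * Re (a * cnj b * u)"
proof -
  have "(cmod (a * u + b))\<^sup>2 = (cmod (a * u))\<^sup>2 + (cmod b)\<^sup>2 + 2 * Re (a * u * cnj b)"
    by (simp only: cmod_add_squared)
  then show ?thesis using assms by (simp add: norm_mult mult_ac)
qed

text \<open>With \<open>f = (c z + d) e\<close>, the two squared norms differ by \<open>D
  \<parallel>e\<parallel>\<^sup>2 + 2 Re (k \<langle>z e, e\<rangle>)\<close>. On the unit circle
  the squared moduli differ by \<open>D + 2 Re (k u)\<close>, so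
  \<open>D \<ge> 2 \<bar>k\<bar>\<close>, and this dominates the cross term since
  \<open>\<bar>\<langle>z e, e\<rangle>\<bar> \<le> \<parallel>e\<parallel>\<^sup>2\<close>.\<close>

lemma linear_fractional_multiplier_contraction:
  assumes cd: "cmod c < cmod d"
    and le: "\<And>z. z \<in> unit_disk \<Longrightarrow> cmod (a * z + b) \<le> cmod (c * z + d)"
    and f: "f \<in> H2"
  shows "(\<lambda>z. (a * z + b) / (c * z + d) * f z) \<in> H2"
    and "H2_norm (\<lambda>z. (a * z + b) / (c * z + d) * f z) \<le> H2_norm f"
proof -
  let ?e = "\<lambda>z. f z / (c * z + d)"
  have e: "?e \<in> H2" by (rule division_linear_H2[OF f cd])
  have eq: "(\<lambda>z. (a * z + b) / (c * z + d) * f z) = (\<lambda>z. (a * z + b) * ?e z)" by simp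
  have eq2: "(\<lambda>z. (c * z + d) * ?e z) = f"
  proof
    fix z show "(c * z + d) * ?e z = f z"
      using linear_nonzero_disk[OF cd, of z] H2_outside[OF f, of z] by (cases "z \<in> unit_disk") auto
  qed
  show "(\<lambda>z. (a * z + b) / (c * z + d) * f z) \<in> H2"
    unfolding eq by (rule multiplication_linear_H2[OF e])
  define k where "k = c * cnj d - a * cnj b"
  define D where "D = (cmod c)\<^sup>2 + (cmod d)\<^sup>2 - (cmod a)\<^sup>2 - (cmod b)\<^sup>2"
  have D: "2 * cmod k \<le> D"
  proof -
    \<comment> \<open>The point of the circle where \<open>Re (k * u)\<close> is smallest.\<close>
    obtain u where u: "cmod u = 1" "k * u = - of_real (cmod k)"
    proof (cases "k = 0")
      case False
      show thesis
      proof (rule that)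
        show "cmod (- cnj (sgn k)) = 1" using False by (simp add: norm_sgn)
        have "k * cnj k = of_real (cmod k) * of_real (cmod k)"
          by (metis complex_norm_square power2_eq_square of_real_mult)
        then show "k * (- cnj (sgn k)) = - of_real (cmod k)"
          using False by (simp add: sgn_eq)
      qed
    qed (auto intro: that[of 1])
    have "(cmod (a * u + b))\<^sup>2 \<le> (cmod (c * u + d))\<^sup>2"
      using closed_disk_bound[OF le, of u] u by (intro power_mono) auto
    then have "0 \<le> D + 2 * Re (k * u)"
      unfolding cmod_linear_square[OF u(1)] by (simp add: D_def k_def algebra_simps)
    then show ?thesis using u by simp
  qed
  have "(H2_norm (\<lambda>z. (c * z + d) * ?e z))\<^sup>2 - (H2_norm (\<lambda>z. (a * z + b) * ?e z))\<^sup>2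
      = D * (H2_norm ?e)\<^sup>2 + 2 * Re (k * H2_inner (\<lambda>z. z * ?e z) ?e)"
    unfolding H2_norm_linear_square[OF e] D_def k_def by (simp add: algebra_simps)
  moreover have "- Re (k * H2_inner (\<lambda>z. z * ?e z) ?e) \<le> cmod k * (H2_norm ?e)\<^sup>2"
  proof -
    have "- Re (k * H2_inner (\<lambda>z. z * ?e z) ?e) \<le> cmod k * cmod (H2_inner (\<lambda>z. z * ?e z) ?e)"
      using abs_Re_le_cmod[of "k * H2_inner (\<lambda>z. z * ?e z) ?e"] by (simp add: norm_mult)
    also have "\<dots> \<le> cmod k * (H2_norm (\<lambda>z. z * ?e z) * H2_norm ?e)"
      by (intro mult_left_mono H2_inner_bound H2_shift e) simp
    finally show ?thesis by (simp only: H2_shift(2)[OF e] power2_eq_square)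
  qed
  moreover have "2 * cmod k * (H2_norm ?e)\<^sup>2 \<le> D * (H2_norm ?e)\<^sup>2"
    by (intro mult_right_mono D) simp
  ultimately have "(H2_norm (\<lambda>z. (a * z + b) * ?e z))\<^sup>2 \<le> (H2_norm f)\<^sup>2"
    unfolding eq2 by linarith
  then show "H2_norm (\<lambda>z. (a * z + b) / (c * z + d) * f z) \<le> H2_norm f"
    unfolding eq by (rule power2_le_imp_le) (rule H2_norm_nonneg[OF f])
qed


section \<open>Boundedness of composition operators\<close>

text \<open>Completing the square with \<open>s = 1 - r\<^sup>2\<close>: expand
  \<open>(2 r u - s v)\<^sup>2 / s \<ge> 0\<close> and use \<open>r\<^sup>2 \<le> 1\<close>. This is
  the source of the constant \<open>2 + 4 / (1 - r\<^sup>2)\<close> in the norm bound for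
  composition.\<close>

lemma shift_step_inequality:
  fixes u v r :: real
  assumes "0 \<le> r" "r < 1"
  shows "2 * u\<^sup>2 + 4 * (u * (r * v)) \<le> (2 + 4 / (1 - r\<^sup>2)) * u\<^sup>2 + (1 - r\<^sup>2) * v\<^sup>2"
proof -
  define s where "s = 1 - r\<^sup>2"
  have s: "0 < s" using assms by (simp add: s_def abs_square_less_1)
  have "0 \<le> (2 * r * u - s * v)\<^sup>2 / s" using s by simp
  also have "\<dots> = 4 * r\<^sup>2 * u\<^sup>2 / s - 4 * (u * (r * v)) + s * v\<^sup>2"
    using s by (simp add: power2_eq_square field_simps)
  finally have "4 * (u * (r * v)) \<le> 4 * r\<^sup>2 * u\<^sup>2 / s + s * v\<^sup>2" by simp
  also have "4 * r\<^sup>2 * u\<^sup>2 / s \<le> 4 * u\<^sup>2 / s"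
    using s assms by (intro divide_right_mono mult_right_mono) (auto simp: s_def power_le_one)
  finally show ?thesis unfolding s_def[symmetric] by (simp add: algebra_simps)
qed

text \<open>Littlewood's subordination argument. Writing a polynomial as \<open>f = f 0 + z f\<^sub>1\<close>, the cross
  term in \<open>\<parallel>f 0 + \<phi> \<cdot> (f\<^sub>1 \<circ> \<phi>)\<parallel>\<^sup>2\<close> involves only \<open>f\<^sub>1 (\<phi> 0)\<close>; the extra summand
  \<open>\<bar>f (\<phi> 0)\<bar>\<^sup>2\<close> on the left makes the estimate inductive.\<close>

lemma polynomial_composition_bound:
  assumes maps: "\<And>z. z \<in> unit_disk \<Longrightarrow> \<phi> z \<in> unit_disk"
    and mult_H2: "\<And>f. f \<in> H2 \<Longrightarrow> (\<lambda>z. \<phi> z * f z) \<in> H2"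
    and contr: "\<And>f. f \<in> H2 \<Longrightarrow> H2_norm (\<lambda>z. \<phi> z * f z) \<le> H2_norm f"
  defines "F \<equiv> \<lambda>N a z. if z \<in> unit_disk then \<Sum>n<N. a n * \<phi> z ^ n else 0"
  shows "F N a \<in> H2 \<and> (H2_norm (F N a))\<^sup>2 + (cmod (F N a 0))\<^sup>2
    \<le> (2 + 4 / (1 - (cmod (\<phi> 0))\<^sup>2)) * (\<Sum>n<N. (cmod (a n))\<^sup>2)"
proof (induction N arbitrary: a)
  case 0
  have "F 0 a = (\<lambda>z. 0)" by (auto simp: F_def fun_eq_iff)
  then show ?case by simp
next
  case (Suc N)
  define C where "C = 2 + 4 / (1 - (cmod (\<phi> 0))\<^sup>2)"
  define G where "G = F N (\<lambda>n. a (Suc n))"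
  \<comment> \<open>\<open>szego_kernel 0\<close> is the constant 1 of \<open>H2\<close>; pairing
    with it evaluates at 0.\<close>
  let ?e = "szego_kernel 0" and ?p = "\<phi> 0"
  have G: "G \<in> H2" "(H2_norm G)\<^sup>2 + (cmod (G 0))\<^sup>2 \<le> C * (\<Sum>n<N. (cmod (a (Suc n)))\<^sup>2)"
    using Suc.IH unfolding G_def C_def by auto
  have e: "?e \<in> H2" "(H2_norm ?e)\<^sup>2 = 1" using szego_kernel[of 0] by auto
  have rec: "F (Suc N) a = (\<lambda>z. \<phi> z * G z + a 0 * ?e z)"
    unfolding F_def G_def sum.lessThan_Suc_shift
    by (auto simp: szego_kernel_def sum_distrib_left mult_ac intro!: sum.cong)
  note phiG = mult_H2[OF G(1)]
  have F0: "F (Suc N) a 0 = a 0 + ?p * G 0" by (simp add: rec szego_kernel_def)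
  have in_H2: "F (Suc N) a \<in> H2" unfolding rec by (intro H2_add H2_cmult phiG e)
  have inner: "H2_inner ?e (\<lambda>z. \<phi> z * G z) = cnj (?p * G 0)"
    using H2_inner_commute[OF e(1) phiG] szego_kernel_reproducing[OF _ phiG, of 0] by simp
  have "(H2_norm (F (Suc N) a))\<^sup>2 =
      (H2_norm (\<lambda>z. \<phi> z * G z))\<^sup>2 + 2 * Re (a 0 * cnj (?p * G 0)) + (cmod (a 0))\<^sup>2"
    unfolding rec H2_norm_add_square[OF phiG e(1)] inner e(2) by simp
  moreover have "(H2_norm (\<lambda>z. \<phi> z * G z))\<^sup>2 \<le> (H2_norm G)\<^sup>2"
    by (intro power_mono contr G H2_norm_nonneg phiG)
  moreover have "(cmod (F (Suc N) a 0))\<^sup>2 =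
      (cmod (a 0))\<^sup>2 + (cmod ?p)\<^sup>2 * (cmod (G 0))\<^sup>2 + 2 * Re (a 0 * cnj (?p * G 0))"
    unfolding F0 cmod_add_squared by (simp add: norm_mult power_mult_distrib)
  moreover have "Re (a 0 * cnj (?p * G 0)) \<le> cmod (a 0) * (cmod ?p * cmod (G 0))"
    using complex_Re_le_cmod[of "a 0 * cnj (?p * G 0)"] by (simp add: norm_mult)
  moreover have "2 * (cmod (a 0))\<^sup>2 + 4 * (cmod (a 0) * (cmod ?p * cmod (G 0)))
      \<le> C * (cmod (a 0))\<^sup>2 + (1 - (cmod ?p)\<^sup>2) * (cmod (G 0))\<^sup>2"
    unfolding C_def using maps[of 0] by (intro shift_step_inequality) auto
  moreover have "C * (\<Sum>n<Suc N. (cmod (a n))\<^sup>2) = C * (cmod (a 0))\<^sup>2 + C * (\<Sum>n<N. (cmod (a (Suc n)))\<^sup>2)"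
    by (simp only: sum.lessThan_Suc_shift distrib_left)
  \<comment> \<open>The shares \<open>(cmod ?p)\<^sup>2\<close> and
    \<open>1 - (cmod ?p)\<^sup>2\<close> of \<open>(cmod (G 0))\<^sup>2\<close> add up to exactly
    the extra summand of the induction hypothesis.\<close>
  ultimately have "(H2_norm (F (Suc N) a))\<^sup>2 + (cmod (F (Suc N) a 0))\<^sup>2
      \<le> C * (\<Sum>n<Suc N. (cmod (a n))\<^sup>2)"
    using G(2) by (simp add: algebra_simps)
  then show ?case using in_H2 by (simp add: C_def)
qed

text \<open>Cauchy's estimate on the circle of radius 1/2; the factor \<open>2 ^ n\<close> is
  harmless because it is used for fixed \<open>n\<close>.\<close>

lemma taylor_coeff_bound:
  assumes "f holomorphic_on unit_disk" "\<And>z. cmod z = 1/2 \<Longrightarrow> cmod (f z) \<le> B"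
  shows "cmod (taylor_coeff f n) \<le> B * 2 ^ n"
proof -
  have "cmod ((deriv ^^ n) f 0) \<le> fact n * B / (1/2) ^ n"
  proof (rule Cauchy_inequality)
    show "f holomorphic_on ball 0 (1/2)"
      by (rule holomorphic_on_subset[OF assms(1)]) auto
    show "continuous_on (cball 0 (1/2)) f"
      by (rule continuous_on_subset[OF holomorphic_on_imp_continuous_on[OF assms(1)]]) auto
  qed (auto intro: assms(2))
  then show ?thesis
    by (simp add: taylor_coeff_def norm_divide field_simps power_divide)
qed

text \<open>The bound holds on Taylor polynomials. Their compositions converge coefficientwise, so
  each finite section of the limit inherits the bound, as in Fatou's lemma.\<close>

lemma bounded_operator_composition:
  assumes hol: "\<phi> holomorphic_on unit_disk"
    and maps: "\<And>z. z \<in> unit_disk \<Longrightarrow> \<phi> z \<in> unit_disk"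
    and mult_H2: "\<And>f. f \<in> H2 \<Longrightarrow> (\<lambda>z. \<phi> z * f z) \<in> H2"
    and contr: "\<And>f. f \<in> H2 \<Longrightarrow> H2_norm (\<lambda>z. \<phi> z * f z) \<le> H2_norm f"
  shows "bounded_operator (composition_operator \<phi>)"
proof -
  let ?C = "composition_operator \<phi>"
  define K where "K = sqrt (2 + 4 / (1 - (cmod (\<phi> 0))\<^sup>2))"
  have "(cmod (\<phi> 0))\<^sup>2 < 1" using maps[of 0] by (simp add: abs_square_less_1)
  then have K0: "K \<ge> 0" and K2: "K\<^sup>2 = 2 + 4 / (1 - (cmod (\<phi> 0))\<^sup>2)"
    by (auto simp: K_def)
  have chol: "?C f holomorphic_on unit_disk" if "f holomorphic_on unit_disk" for f
  proof -
    have "(\<lambda>z. f (\<phi> z)) holomorphic_on unit_disk"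
      using holomorphic_on_compose_gen[OF hol that image_subsetI[OF maps]] by (simp add: o_def)
    then show ?thesis
      by (rule holomorphic_transform) (simp add: composition_operator_def)
  qed
  have part: "?C (H2_partial N f) \<in> H2" "H2_norm (?C (H2_partial N f)) \<le> K * H2_norm f"
    if f: "f \<in> H2" for f N
  proof -
    have eq: "?C (H2_partial N f) = (\<lambda>z. if z \<in> unit_disk then \<Sum>n<N. taylor_coeff f n * \<phi> z ^ n else 0)"
      using maps by (auto simp: composition_operator_def H2_partial_def H2_monom_def fun_eq_iff)
    note * = polynomial_composition_bound[OF maps mult_H2 contr, where N=N and a="taylor_coeff f", folded eq]
    from * show "?C (H2_partial N f) \<in> H2" by blast
    have "(H2_norm (?C (H2_partial N f)))\<^sup>2 \<le> K\<^sup>2 * (\<Sum>n<N. (cmod (taylor_coeff f n))\<^sup>2)"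
      using * unfolding K2 by (smt (verit) zero_le_power2)
    also have "\<dots> \<le> K\<^sup>2 * (H2_norm f)\<^sup>2"
      unfolding H2_norm_square[OF f]
      by (intro mult_left_mono sum_le_suminf H2_summable f) auto
    finally show "H2_norm (?C (H2_partial N f)) \<le> K * H2_norm f"
      unfolding power_mult_distrib[symmetric]
      by (rule power2_le_imp_le) (simp add: K0 H2_norm_nonneg f)
  qed
  \<comment> \<open>By compactness \<phi> maps the closed disk of radius 1/2 into a disk of radius
    below 1, where point evaluations are uniformly bounded.\<close>
  obtain \<rho> where rho: "\<rho> < 1" "\<And>z. cmod z \<le> 1/2 \<Longrightarrow> cmod (\<phi> z) \<le> \<rho>"
  proof -
    have "continuous_on (cball 0 (1/2)) (\<lambda>z. cmod (\<phi> z))"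
      by (intro continuous_on_norm continuous_on_subset[OF holomorphic_on_imp_continuous_on[OF hol]]) auto
    from continuous_attains_sup[OF compact_cball _ this]
    obtain x where "x \<in> cball 0 (1/2)" "\<forall>y\<in>cball 0 (1/2). cmod (\<phi> y) \<le> cmod (\<phi> x)" by auto
    then show thesis using maps[of x] by (intro that[of "cmod (\<phi> x)"]) auto
  qed
  have rho0: "0 \<le> \<rho>" using order_trans[OF norm_ge_zero rho(2)[of 0]] by simp
  have tends: "(\<lambda>N. taylor_coeff (?C (H2_partial N f)) n) \<longlonglongrightarrow> taylor_coeff (?C f) n"
    if f: "f \<in> H2" for f n
  proof (rule LIM_zero_cancel, rule Lim_null_comparison)
    let ?d = "\<lambda>N z. f z - H2_partial N f z"
    show "(\<lambda>N. H2_norm (?d N) / sqrt (1 - \<rho>\<^sup>2) * 2 ^ n) \<longlonglongrightarrow> 0"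
      using tendsto_mult[OF tendsto_divide[OF H2_partial_tendsto[OF f] tendsto_const[of "sqrt (1 - \<rho>\<^sup>2)"]]
          tendsto_const[of "2 ^ n"]] rho rho0 by (simp add: power2_eq_1_iff)
    have "norm (taylor_coeff (?C (H2_partial N f)) n - taylor_coeff (?C f) n)
        \<le> H2_norm (?d N) / sqrt (1 - \<rho>\<^sup>2) * 2 ^ n" for N
    proof -
      have d: "?d N \<in> H2" by (intro H2_diff H2_partial_in_H2 f)
      have "taylor_coeff (?C f) n - taylor_coeff (?C (H2_partial N f)) n
          = taylor_coeff (\<lambda>z. ?C f z - ?C (H2_partial N f) z) n"
        by (intro taylor_coeff_diff[symmetric] chol H2_holomorphic f H2_partial_in_H2)
      moreover have "cmod (taylor_coeff (\<lambda>z. ?C f z - ?C (H2_partial N f) z) n)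
          \<le> H2_norm (?d N) / sqrt (1 - \<rho>\<^sup>2) * 2 ^ n"
      proof (rule taylor_coeff_bound)
        show "(\<lambda>z. ?C f z - ?C (H2_partial N f) z) holomorphic_on unit_disk"
          by (intro holomorphic_on_diff chol H2_holomorphic f H2_partial_in_H2)
        fix z :: complex assume z: "cmod z = 1/2"
        then have zd: "z \<in> unit_disk" by simp
        have "cmod (?C f z - ?C (H2_partial N f) z) = cmod (?d N (\<phi> z))"
          using zd by (simp add: composition_operator_def)
        also have "\<dots> \<le> H2_norm (?d N) / sqrt (1 - (cmod (\<phi> z))\<^sup>2)"
          by (rule H2_pointwise_bound[OF d maps[OF zd]])
        also have "\<dots> \<le> H2_norm (?d N) / sqrt (1 - \<rho>\<^sup>2)"
          using rho(2)[of z] z rho(1) rho0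
          by (intro divide_left_mono H2_norm_nonneg d)
            (auto intro!: mult_pos_pos power_mono maps[OF zd, simplified] simp: abs_square_less_1)
        finally show "cmod (?C f z - ?C (H2_partial N f) z) \<le> H2_norm (?d N) / sqrt (1 - \<rho>\<^sup>2)" .
      qed
      ultimately show ?thesis by (simp add: norm_minus_commute)
    qed
    then show "\<forall>\<^sub>F N in sequentially. norm (taylor_coeff (?C (H2_partial N f)) n - taylor_coeff (?C f) n)
        \<le> H2_norm (?d N) / sqrt (1 - \<rho>\<^sup>2) * 2 ^ n" by simp
  qed
  have bd: "L2_set (\<lambda>n. cmod (taylor_coeff (?C f) n)) {..<M} \<le> K * H2_norm f" if f: "f \<in> H2" for f M
  proof (rule LIMSEQ_le_const2)
    show "(\<lambda>N. L2_set (\<lambda>n. cmod (taylor_coeff (?C (H2_partial N f)) n)) {..<M})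
        \<longlonglongrightarrow> L2_set (\<lambda>n. cmod (taylor_coeff (?C f) n)) {..<M}"
      unfolding L2_set_def by (intro tendsto_intros tends f)
    show "\<exists>N. \<forall>n\<ge>N. L2_set (\<lambda>i. cmod (taylor_coeff (?C (H2_partial n f)) i)) {..<M} \<le> K * H2_norm f"
      using order_trans[OF L2_set_le_H2_norm[OF part(1)[OF f]] part(2)[OF f]] by blast
  qed
  have main: "?C f \<in> H2 \<and> H2_norm (?C f) \<le> K * H2_norm f" if f: "f \<in> H2" for f
  proof -
    note * = summable_square_boundedI[OF bd[OF f]]
    have "?C f \<in> H2"
      using chol[OF H2_holomorphic[OF f]] *(1) by (auto simp: H2_def composition_operator_def)
    then show ?thesis using *(2) by (simp add: H2_norm_def)
  qed
  show ?thesis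
    unfolding bounded_operator_def using main
    by (auto simp: composition_operator_def fun_eq_iff)
qed


section \<open>Linear-fractional selfmaps of the disk\<close>

text \<open>Comparing moduli instead of bounding a quotient excludes poles in the disk, as a strict
  inequality forces a nonzero denominator, and passes to the closed disk by continuity.\<close>

locale lf_selfmap =
  fixes a b c d :: complex
  assumes det: "a * d - b * c \<noteq> 0"
    and less: "z \<in> unit_disk \<Longrightarrow> cmod (a * z + b) < cmod (c * z + d)"
begin

definition lf_map :: "complex \<Rightarrow> complex" where
  "lf_map z = (a * z + b) / (c * z + d)"

text \<open>At a zero of the denominator the numerator would vanish too, contradicting
  \<open>det\<close>.\<close>

lemma closed_disk_nonzero:
  assumes "cmod z \<le> 1"
  shows "c * z + d \<noteq> 0"
proof
  assume 0: "c * z + d = 0"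
  then have "a * z + b = 0"
    using closed_disk_bound[OF less_imp_le[OF less] assms] by simp
  then have "a * d - b * c = 0" using 0 by algebra
  with det show False ..
qed

text \<open>Since \<open>\<bar>\<phi>\<bar> \<le> 1\<close> on the closed disk, \<open>1 - cnj z * \<phi> w\<close> has no zero \<open>w\<close> there,
  which locates the zero of its numerator.\<close>

lemma conjugate_less:
  assumes z: "z \<in> unit_disk"
  shows "cmod (c - cnj z * a) < cmod (d - cnj z * b)"
proof (rule ccontr)
  let ?p = "c - cnj z * a" and ?q = "d - cnj z * b"
  assume "\<not> cmod ?p < cmod ?q"
  then have le: "cmod ?q \<le> cmod ?p" by simp
  \<comment> \<open>The zero of the numerator of \<open>1 - cnj z * \<phi> w\<close>. If
    \<open>?p = 0\<close> then \<open>?q = 0\<close> as well, and 0 serves.\<close>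
  obtain w where w: "cmod w \<le> 1" "?p * w + ?q = 0"
  proof (cases "?p = 0")
    case True
    then show thesis using le by (intro that[of 0]) auto
  next
    case False
    then show thesis using le norm_minus_commute[of d "cnj z * b"]
      by (intro that[of "- ?q / ?p"]) (auto simp: norm_divide divide_simps)
  qed
  then have eq: "c * w + d = cnj z * (a * w + b)" by algebra
  have nz: "c * w + d \<noteq> 0" by (rule closed_disk_nonzero[OF w(1)])
  have "cmod (c * w + d) = cmod z * cmod (a * w + b)" by (simp add: eq norm_mult)
  also have "\<dots> \<le> cmod z * cmod (c * w + d)"
    by (intro mult_left_mono closed_disk_bound[OF less_imp_le[OF less] w(1)]) auto
  also have "\<dots> < 1 * cmod (c * w + d)" using z nz by (intro mult_strict_right_mono) auto
  finally show False by simp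
qed

lemma pole_outside: "cmod c < cmod d"
  using conjugate_less[of 0] by simp

lemma value_at_zero: "cmod b < cmod d"
  using less[of 0] by simp

lemma lf_map_in_disk: "z \<in> unit_disk \<Longrightarrow> lf_map z \<in> unit_disk"
  using less[of z] closed_disk_nonzero[of z] by (simp add: lf_map_def norm_divide)

lemma lf_map_holomorphic: "lf_map holomorphic_on unit_disk"
  unfolding lf_map_def using closed_disk_nonzero by (auto intro!: holomorphic_intros)

lemma bounded_operator_map: "bounded_operator (composition_operator lf_map)"
proof (rule bounded_operator_composition[OF lf_map_holomorphic lf_map_in_disk])
  fix f assume "f \<in> H2"
  from linear_fractional_multiplier_contraction[OF pole_outside less_imp_le[OF less] this]
  show "(\<lambda>z. lf_map z * f z) \<in> H2" "H2_norm (\<lambda>z. lf_map z * f z) \<le> H2_norm f"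
    unfolding lf_map_def by blast+
qed

text \<open>The conjugate of \<open>conjugate_less\<close> is exactly the selfmap inequality for
  \<sigma>.\<close>

lemma adjoint_selfmap: "lf_selfmap (cnj a) (- cnj c) (- cnj b) (cnj d)"
proof
  show "cnj a * cnj d - - cnj c * - cnj b \<noteq> 0"
    using det by (metis complex_cnj_cancel_iff complex_cnj_diff complex_cnj_mult complex_cnj_zero
        minus_mult_minus mult.commute)
  fix z :: complex assume "z \<in> unit_disk"
  from conjugate_less[OF this] have "cmod (cnj (c - cnj z * a)) < cmod (cnj (d - cnj z * b))"
    by (simp only: complex_mod_cnj)
  then show "cmod (cnj a * z + - cnj c) < cmod (- cnj b * z + cnj d)"
    by (simp add: norm_minus_commute mult.commute)
qed

lemma lf_map_inj: "inj_on lf_map unit_disk"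
proof (rule inj_onI)
  fix x y assume x: "x \<in> unit_disk" and y: "y \<in> unit_disk" and "lf_map x = lf_map y"
  then have "(a * x + b) * (c * y + d) = (a * y + b) * (c * x + d)"
    using closed_disk_nonzero[of x] closed_disk_nonzero[of y] by (simp add: lf_map_def frac_eq_eq)
  then have "(a * d - b * c) * (x - y) = 0" by algebra
  then show "x = y" using det by simp
qed

end

section \<open>Selfmaps, composition and inverses on the extended plane\<close>

lemma disk_selfmap_linear_fractional_iff:
  "disk_selfmap (linear_fractional a b c d) \<longleftrightarrow>
    (\<forall>z\<in>unit_disk. cmod (a * z + b) < cmod (c * z + d))"
proof -
  \<comment> \<open>At a pole both sides fail: the value is \<open>Infty\<close>, and no modulus is
    below 0.\<close>
  have "linear_fractional a b c d (Fin z) \<in> Fin ` unit_disk \<longleftrightarrow> cmod (a * z + b) < cmod (c * z + d)" for z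
    by (auto simp: norm_divide divide_less_eq)
  then show ?thesis unfolding disk_selfmap_def by blast
qed

text \<open>Coefficients multiply as 2 by 2 matrices. At a pole of the inner map its nonzero
  determinant keeps the numerator away from 0, so the value at \<open>Infty\<close> comes out
  right.\<close>

lemma linear_fractional_compose:
  assumes "a * d - b * c \<noteq> 0" "a' * d' - b' * c' \<noteq> 0"
  shows "linear_fractional a b c d (linear_fractional a' b' c' d' w) =
    linear_fractional (a * a' + b * c') (a * b' + b * d') (c * a' + d * c') (c * b' + d * d') w"
proof (cases w)
  case (Fin z)
  define N D where "N = a' * z + b'" and "D = c' * z + d'"
  have eqs: "(a * a' + b * c') * z + (a * b' + b * d') = a * N + b * D"
    "(c * a' + d * c') * z + (c * b' + d * d') = c * N + d * D"
    by (auto simp: N_def D_def algebra_simps)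
  show ?thesis
  proof (cases "D = 0")
    case True
    have "N \<noteq> 0"
    proof
      assume "N = 0"
      then have "a' * d' - b' * c' = 0" using True unfolding N_def D_def by algebra
      with assms show False by simp
    qed
    then show ?thesis using Fin True by (simp add: eqs flip: N_def D_def)
  next
    case False
    have "c * (N / D) + d = (c * N + d * D) / D" "a * (N / D) + b = (a * N + b * D) / D"
      using False by (auto simp: field_simps)
    then show ?thesis using Fin False by (simp add: eqs flip: N_def D_def)
  qed
next
  case Infty
  show ?thesis
  proof (cases "c' = 0")
    case True
    then show ?thesis using assms Infty by auto
  next
    case False
    have "c * (a' / c') + d = (c * a' + d * c') / c'" "a * (a' / c') + b = (a * a' + b * c') / c'"
      using False by (auto simp: field_simps)
    then show ?thesis using Infty False by simp
  qed
qed

lemma inv_linear_fractional: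
  assumes "a * d - b * c \<noteq> 0"
  shows "inv (linear_fractional a b c d) = linear_fractional d (- b) (- c) a"
proof (rule inv_equality)
  have "d * a - - b * - c \<noteq> 0" using assms by (simp add: mult.commute)
  from linear_fractional_inverse[OF this]
  show "linear_fractional a b c d (linear_fractional d (- b) (- c) a w) = w" for w by simp
qed (rule linear_fractional_inverse[OF assms])


section \<open>Cowen's adjoint formula\<close>

text \<open>\<open>T\<^sub>h\<^sup>*\<close> is onto: the adjoint of multiplication by
  \<open>1 / h\<close> is a right inverse, because \<open>1 / h\<close> times \<open>h\<close> is 1
  on the disk.\<close>

lemma adjoint_multiplication_cancel:
  assumes "cmod c < cmod d" "s \<in> H2"
  shows "adjoint_operator (multiplication_operator (\<lambda>z. c * z + d))
    (adjoint_operator (multiplication_operator (\<lambda>z. 1 / (c * z + d))) s) = s"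
proof -
  let ?T = "multiplication_operator (\<lambda>z. c * z + d)"
  let ?R = "multiplication_operator (\<lambda>z. 1 / (c * z + d))"
  note T = bounded_operator_linear[of c d] and R = bounded_operator_inverse_linear[OF assms(1), of 1]
  show ?thesis
  proof (rule adjoint_operator_eqI[OF T adjoint_operator_H2[OF R assms(2)] assms(2)])
    fix k assume k: "k \<in> H2"
    have "?R (?T k) = k"
    proof
      fix z show "?R (?T k) z = k z"
        using linear_nonzero_disk[OF assms(1), of z] H2_outside[OF k, of z]
        by (cases "z \<in> unit_disk") (auto simp: multiplication_operator_def)
    qed
    then show "H2_inner (?T k) (adjoint_operator ?R s) = H2_inner k s"
      using adjoint_operator_inner[OF R assms(2) bounded_operator_H2[OF T k]] by simp
  qed
qed

context lf_selfmap
begin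

text \<open>This is \<sigma> on the disk, itself an instance of the locale; \<open>weight\<close>
  below is Cowen's \<open>g\<close>.\<close>

abbreviation adj_map :: "complex \<Rightarrow> complex" where
  "adj_map \<equiv> lf_selfmap.lf_map (cnj a) (- cnj c) (- cnj b) (cnj d)"

lemmas adj_det = lf_selfmap.det[OF adjoint_selfmap]
  and adj_less = lf_selfmap.less[OF adjoint_selfmap]
  and adj_closed_disk_nonzero = lf_selfmap.closed_disk_nonzero[OF adjoint_selfmap]
  and adj_map_def = lf_selfmap.lf_map_def[OF adjoint_selfmap]
  and adj_map_in_disk = lf_selfmap.lf_map_in_disk[OF adjoint_selfmap]
  and adj_map_holomorphic = lf_selfmap.lf_map_holomorphic[OF adjoint_selfmap]
  and adj_map_inj = lf_selfmap.lf_map_inj[OF adjoint_selfmap]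

abbreviation weight :: "complex \<Rightarrow> complex" where
  "weight z \<equiv> 1 / (- cnj b * z + cnj d)"

lemma weight_nonzero: "cmod z \<le> 1 \<Longrightarrow> - cnj b * z + cnj d \<noteq> 0"
  using adj_closed_disk_nonzero by simp

text \<open>With \<open>p = d - b * cnj w\<close>, the reciprocal of \<open>cnj (weight w)\<close>,
  the numerator of \<open>1 - cnj w * lf_map z\<close> is \<open>p - (a * cnj w - c) * z\<close>;
  factoring out \<open>p\<close> leaves the denominator of the kernel at
  \<open>adj_map w\<close>.\<close>

lemma composition_kernel:
  assumes w: "w \<in> unit_disk"
  shows "composition_operator lf_map (szego_kernel w) =
    (\<lambda>z. cnj (weight w) * multiplication_operator (\<lambda>z. c * z + d) (szego_kernel (adj_map w)) z)"
proof
  fix z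
  show "composition_operator lf_map (szego_kernel w) z =
    cnj (weight w) * multiplication_operator (\<lambda>z. c * z + d) (szego_kernel (adj_map w)) z"
  proof (cases "z \<in> unit_disk")
    case True
    define p where "p = d - b * cnj w"
    have p: "p \<noteq> 0" using weight_nonzero[of w] w arg_cong[of p 0 cnj]
      by (auto simp: p_def)
    have h: "c * z + d \<noteq> 0" using closed_disk_nonzero True by simp
    have cs: "cnj (adj_map w) = (a * cnj w - c) / p" by (simp add: p_def adj_map_def)
    have "szego_kernel w (lf_map z) = 1 / (1 - cnj w * ((a * z + b) / (c * z + d)))"
      using lf_map_in_disk[OF True] by (simp add: szego_kernel_def lf_map_def)
    also have "1 - cnj w * ((a * z + b) / (c * z + d)) = (p - (a * cnj w - c) * z) / (c * z + d)"
      using h by (simp add: p_def field_simps)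
    also have "p - (a * cnj w - c) * z = p * (1 - (a * cnj w - c) / p * z)"
      using p by (simp add: right_diff_distrib)
    also have "1 / (\<dots> / (c * z + d)) = 1 / p * ((c * z + d) * (1 / (1 - (a * cnj w - c) / p * z)))"
      by simp
    finally show ?thesis
      using True by (simp add: composition_operator_def multiplication_operator_def cs
          szego_kernel_def[of "adj_map w"] flip: p_def)
  qed (simp add: composition_operator_def multiplication_operator_def szego_kernel_def)
qed

text \<open>Evaluation at \<open>w\<close> is pairing with the kernel at \<open>w\<close>; the
  operator moves onto the kernel, where \<open>composition_kernel\<close> applies.\<close>

lemma adjoint_formula:
  assumes f: "f \<in> H2"
  shows "adjoint_operator (composition_operator lf_map) f =
    multiplication_operator weight (composition_operator adj_map
      (adjoint_operator (multiplication_operator (\<lambda>z. c * z + d)) f))"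
proof
  let ?C = "composition_operator lf_map" and ?T = "multiplication_operator (\<lambda>z. c * z + d)"
  note C = bounded_operator_map and T = bounded_operator_linear[of c d]
  fix w
  show "adjoint_operator ?C f w =
    multiplication_operator weight (composition_operator adj_map (adjoint_operator ?T f)) w"
  proof (cases "w \<in> unit_disk")
    case True
    let ?k = "szego_kernel w" and ?l = "szego_kernel (adj_map w)"
    note k = szego_kernel_in_H2[OF True] and l = szego_kernel_in_H2[OF adj_map_in_disk[OF True]]
    have "adjoint_operator ?C f w = H2_inner (adjoint_operator ?C f) ?k"
      by (simp only: szego_kernel_reproducing[OF True adjoint_operator_H2[OF C f]])
    also have "\<dots> = H2_inner f (?C ?k)" by (rule adjoint_operator_inner'[OF C f k])
    also have "\<dots> = weight w * H2_inner f (?T ?l)"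
      unfolding composition_kernel[OF True]
      by (subst H2_inner_cmult_right[OF bounded_operator_H2[OF T l] f]) (simp only: complex_cnj_cnj)
    also have "\<dots> = weight w * adjoint_operator ?T f (adj_map w)"
      by (simp only: adjoint_operator_inner'[OF T f l, symmetric]
          szego_kernel_reproducing[OF adj_map_in_disk[OF True] adjoint_operator_H2[OF T f]])
    finally show ?thesis using True by (simp add: multiplication_operator_def composition_operator_def)
  next
    case False
    then show ?thesis using H2_outside[OF adjoint_operator_H2[OF C f] False]
      by (simp add: multiplication_operator_def composition_operator_def)
  qed
qed

text \<open>Cowen's formula with \<open>T\<^sub>h\<^sup>*\<close> undone: every
  \<open>g \<cdot> (s \<circ> \<sigma>)\<close> with \<open>s\<close> in \<open>H2\<close> lies in
  the range of the adjoint. Both directions of the theorem use this.\<close>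

lemma adjoint_of_lift:
  assumes "s \<in> H2"
  shows "adjoint_operator (composition_operator lf_map)
      (adjoint_operator (multiplication_operator (\<lambda>z. 1 / (c * z + d))) s) =
    multiplication_operator weight (composition_operator adj_map s)"
  by (subst adjoint_formula[OF adjoint_operator_H2[OF bounded_operator_inverse_linear[OF pole_outside] assms]])
    (simp only: adjoint_multiplication_cancel[OF pole_outside assms])


section \<open>Posinormality\<close>

text \<open>\<open>\<phi> \<circ> \<sigma>\<^sup>-\<^sup>1 = num / den\<close>.\<close>

definition num :: "complex \<Rightarrow> complex" where
  "num y = (a * cnj d + b * cnj b) * y + (a * cnj c + b * cnj a)"

definition den :: "complex \<Rightarrow> complex" where
  "den y = (c * cnj d + d * cnj b) * y + (c * cnj c + d * cnj a)"

text \<open>The matrix of \<open>\<phi> \<circ> \<sigma>\<^sup>-\<^sup>1\<close> uses the adjugate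
  of that of \<sigma>, so composing with \<sigma> returns the matrix of \<phi> times
  \<open>cnj (a * d - b * c)\<close>; \<open>weight w\<close> comes from the denominator of
  \<sigma>.\<close>

lemma num_den_adj_map:
  assumes "w \<in> unit_disk"
  shows "num (adj_map w) = (cnj (a * d - b * c) * weight w) * (a * w + b)"
    and "den (adj_map w) = (cnj (a * d - b * c) * weight w) * (c * w + d)"
  using weight_nonzero[of w] assms
  by (simp_all add: num_def den_def adj_map_def divide_simps) (simp_all add: algebra_simps)

lemma den_adj_map_nonzero: "w \<in> unit_disk \<Longrightarrow> den (adj_map w) \<noteq> 0"
  using num_den_adj_map(2)[of w] det weight_nonzero[of w] closed_disk_nonzero[of w]
  by (metis complex_cnj_zero_iff divide_eq_0_iff less_imp_le mem_ball_0 mult_eq_0_iff zero_neq_one)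

lemma quotient_adj_map:
  assumes "w \<in> unit_disk"
  shows "num (adj_map w) / den (adj_map w) = lf_map w"
  using den_adj_map_nonzero[OF assms] unfolding num_den_adj_map[OF assms] lf_map_def by auto

lemma quotient_det:
  "(a * cnj d + b * cnj b) * (c * cnj c + d * cnj a) - (a * cnj c + b * cnj a) * (c * cnj d + d * cnj b) \<noteq> 0"
proof -
  have "(a * cnj d + b * cnj b) * (c * cnj c + d * cnj a) - (a * cnj c + b * cnj a) * (c * cnj d + d * cnj b)
    = (a * d - b * c) * cnj (a * d - b * c)" by (simp add: algebra_simps)
  then show ?thesis using det by (metis complex_cnj_zero_iff mult_eq_0_iff)
qed

text \<open>\<open>C\<^sub>\<phi> = C\<^sub>\<phi>\<^sup>* X\<close> with
  \<open>X = R\<^sup>* Q S\<close>: by \<open>adjoint_of_lift\<close> the right side is \<open>g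
  \<cdot> (q \<circ> \<sigma>) \<cdot> (f \<circ> \<tau> \<circ> \<sigma>)\<close>, where
  \<open>g \<cdot> (q \<circ> \<sigma>) = 1\<close> and
  \<open>\<tau> \<circ> \<sigma> = \<phi>\<close>.\<close>

lemma posinormal_if_quotient_selfmap:
  assumes zero: "cmod b < cmod a"
    and sub: "\<And>y. y \<in> unit_disk \<Longrightarrow> cmod (num y) < cmod (den y)"
  shows "posinormal (composition_operator lf_map)"
proof -
  interpret q: lf_selfmap "a * cnj d + b * cnj b" "a * cnj c + b * cnj a"
    "c * cnj d + d * cnj b" "c * cnj c + d * cnj a"
    using quotient_det sub by unfold_locales (auto simp: num_def den_def)
  let ?\<Delta> = "cnj (a * d - b * c)"
  define R where "R = multiplication_operator (\<lambda>z. 1 / (c * z + d))"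
  \<comment> \<open>The multiplier is the reciprocal of \<open>weight\<close> composed with
    \<open>\<sigma>\<^sup>-\<^sup>1\<close>; it is bounded because \<open>zero\<close> keeps its
    pole off the closed disk.\<close>
  define Q where "Q = multiplication_operator (\<lambda>z. ?\<Delta> / (cnj b * z + cnj a))"
  define S where "S = composition_operator q.lf_map"
  have R: "bounded_operator (adjoint_operator R)"
    unfolding R_def by (intro bounded_operator_adjoint bounded_operator_inverse_linear pole_outside)
  have Q: "bounded_operator Q"
    unfolding Q_def by (rule bounded_operator_inverse_linear) (simp add: zero)
  have S: "bounded_operator S" unfolding S_def by (rule q.bounded_operator_map)
  show ?thesis
  proof (rule posinormalI_factor[OF bounded_operator_map])
    show "bounded_operator (\<lambda>f. adjoint_operator R (Q (S f)))"
      by (rule bounded_operator_comp[OF R bounded_operator_comp[OF Q S]])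
    fix f assume f: "f \<in> H2"
    have "Q (S f) \<in> H2" using bounded_operator_H2[OF Q] bounded_operator_H2[OF S f] by blast
    from adjoint_of_lift[OF this, folded R_def]
    have eq: "adjoint_operator (composition_operator lf_map) (adjoint_operator R (Q (S f))) =
      multiplication_operator weight (composition_operator adj_map (Q (S f)))" .
    show "composition_operator lf_map f =
        adjoint_operator (composition_operator lf_map) (adjoint_operator R (Q (S f)))"
    proof
      fix w
      show "composition_operator lf_map f w =
          adjoint_operator (composition_operator lf_map) (adjoint_operator R (Q (S f))) w"
      proof (cases "w \<in> unit_disk")
        case True
        have nz: "- cnj b * w + cnj d \<noteq> 0" using weight_nonzero True by simp
        have "cnj b * adj_map w + cnj a = ?\<Delta> * weight w"
          using nz by (simp add: adj_map_def divide_simps) (simp add: algebra_simps)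
        moreover have "?\<Delta> \<noteq> 0" using det complex_cnj_zero_iff by blast
        ultimately have 1: "weight w * (?\<Delta> / (cnj b * adj_map w + cnj a)) = 1"
          using nz by (simp del: complex_cnj_diff complex_cnj_mult)
        have "q.lf_map (adj_map w) = lf_map w"
          using quotient_adj_map[OF True] by (simp add: q.lf_map_def num_def den_def)
        then have "S f (adj_map w) = f (lf_map w)"
          using adj_map_in_disk[OF True] by (simp add: S_def composition_operator_def)
        then have "multiplication_operator weight (composition_operator adj_map (Q (S f))) w =
          (weight w * (?\<Delta> / (cnj b * adj_map w + cnj a))) * f (lf_map w)"
          using True by (simp add: Q_def multiplication_operator_def composition_operator_def mult.assoc)
        then show ?thesis unfolding eq 1 using True by (simp add: composition_operator_def)
      next
        case False
        then show ?thesis unfolding eq by (simp add: multiplication_operator_def composition_operator_def)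
      qed
    qed
  qed
qed

section \<open>Weighted powers of a Blaschke factor as test functions\<close>

lemma blaschke_le_iff:
  "cmod (d * x - b * y) \<le> cmod (cnj d * y - cnj b * x) \<longleftrightarrow> cmod x \<le> cmod y"
proof -
  \<comment> \<open>The usual identity for a Blaschke factor at \<open>x / y\<close>, in homogeneous
    form so that \<open>y = 0\<close> is allowed.\<close>
  have eq: "(cmod (cnj d * y - cnj b * x))\<^sup>2 - (cmod (d * x - b * y))\<^sup>2
      = ((cmod d)\<^sup>2 - (cmod b)\<^sup>2) * ((cmod y)\<^sup>2 - (cmod x)\<^sup>2)"
    unfolding cmod_power2 by (simp add: power2_eq_square algebra_simps)
  have pos: "0 < (cmod d)\<^sup>2 - (cmod b)\<^sup>2"
    using value_at_zero power_strict_mono[of "cmod b" "cmod d" 2] by simp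
  have sq: "s \<le> t \<longleftrightarrow> 0 \<le> t\<^sup>2 - s\<^sup>2" if "0 \<le> s" "0 \<le> t" for s t :: real
    using that abs_le_square_iff[of s t] by simp
  have cancel: "0 \<le> s * t \<longleftrightarrow> 0 \<le> t" if "0 < s" for s t :: real
    using that by (simp add: zero_le_mult_iff)
  show ?thesis
    unfolding sq[OF norm_ge_zero norm_ge_zero] eq by (rule cancel[OF pos])
qed

lemma blaschke_le:
  assumes "cmod z \<le> 1"
  shows "cmod (d * z - b) \<le> cmod (cnj d - cnj b * z)"
  using blaschke_le_iff[of z 1] assms by simp

text \<open>\<open>blaschke n\<close> is the weight times the \<open>n\<close>-th power of the Blaschke factor vanishing at
  \<open>\<phi> 0\<close>; this factor is a polynomial of degree 1 in \<open>\<sigma>\<close>, so \<open>blaschke n\<close> lies in the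
  range of the adjoint.\<close>

definition blaschke :: "nat \<Rightarrow> complex \<Rightarrow> complex" where
  "blaschke n z = (if z \<in> unit_disk then weight z * ((d * z - b) / (cnj d - cnj b * z)) ^ n else 0)"

text \<open>The Blaschke factor is a contractive multiplier, so the norms stay bounded as
  \<open>n\<close> grows.\<close>

lemma blaschke_H2: "blaschke n \<in> H2 \<and> H2_norm (blaschke n) \<le> H2_norm (blaschke 0)"
proof (induction n)
  case 0
  have "blaschke 0 = multiplication_operator weight (szego_kernel 0)"
    by (auto simp: blaschke_def szego_kernel_def multiplication_operator_def)
  moreover have "cmod (- cnj b) < cmod (cnj d)" using value_at_zero by simp
  ultimately have "blaschke 0 \<in> H2"
    using bounded_operator_H2[OF bounded_operator_inverse_linear szego_kernel_in_H2[of 0]]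
    by (metis centre_in_ball zero_less_one)
  then show ?case by simp
next
  case (Suc n)
  have eq: "blaschke (Suc n) = (\<lambda>z. (d * z + - b) / (- cnj b * z + cnj d) * blaschke n z)"
    unfolding fun_eq_iff blaschke_def by (simp add: mult.left_commute)
  have pole: "cmod (- cnj b) < cmod (cnj d)" using value_at_zero by simp
  have le: "cmod (d * z + - b) \<le> cmod (- cnj b * z + cnj d)" if "z \<in> unit_disk" for z
    using blaschke_le[of z] that by simp
  note contraction = linear_fractional_multiplier_contraction[OF pole le conjunct1[OF Suc], folded eq]
  show ?case by (rule conjI[OF contraction(1) order_trans[OF contraction(2) conjunct2[OF Suc]]])
qed

lemma blaschke_in_range:
  obtains f where "f \<in> H2" "adjoint_operator (composition_operator lf_map) f = blaschke n"
proof -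
  let ?\<Delta> = "cnj (a * d - b * c)"
  \<comment> \<open>\<sigma> and the Blaschke factor share the denominator
    \<open>cnj d - cnj b * w\<close>; \<alpha> and \<beta> are the constants for which
    \<open>\<alpha> * adj_map w + \<beta>\<close> is that factor.\<close>
  define \<alpha> where "\<alpha> = (d * cnj d - b * cnj b) / ?\<Delta>"
  define \<beta> where "\<beta> = (d * cnj c - b * cnj a) / ?\<Delta>"
  define s where "s n z = (if z \<in> unit_disk then (\<alpha> * z + \<beta>) ^ n else 0)" for n z
  have s: "s n \<in> H2" for n
  proof (induction n)
    case 0
    have "s 0 = szego_kernel 0" by (auto simp: s_def szego_kernel_def)
    then show ?case using szego_kernel_in_H2[of 0] by simp
  next
    case (Suc n)
    have "s (Suc n) = (\<lambda>z. (\<alpha> * z + \<beta>) * s n z)" by (auto simp: s_def)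
    then show ?case using multiplication_linear_H2(1)[OF Suc] by simp
  qed
  have eq: "multiplication_operator weight (composition_operator adj_map (s n)) = blaschke n"
  proof
    fix w show "multiplication_operator weight (composition_operator adj_map (s n)) w = blaschke n w"
    proof (cases "w \<in> unit_disk")
      case True
      have nz: "cnj d - cnj b * w \<noteq> 0" using weight_nonzero[of w] True by simp
      have D: "?\<Delta> \<noteq> 0" using det complex_cnj_zero_iff by blast
      have adj_eq: "adj_map w = (cnj a * w - cnj c) / (cnj d - cnj b * w)"
        by (simp add: adj_map_def)
      have combine: "p / t * (x / y) + q / t = (p * x + q * y) / (t * y)"
        if "t \<noteq> 0" "y \<noteq> 0" for p q t x y :: complex
        using that by (simp add: field_simps)
      have 1: "\<alpha> * adj_map w + \<beta> =
          ((d * cnj d - b * cnj b) * (cnj a * w - cnj c) + (d * cnj c - b * cnj a) * (cnj d - cnj b * w))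
          / (?\<Delta> * (cnj d - cnj b * w))"
        unfolding \<alpha>_def \<beta>_def adj_eq by (rule combine[OF D nz])
      have 2: "(d * cnj d - b * cnj b) * (cnj a * w - cnj c) + (d * cnj c - b * cnj a) * (cnj d - cnj b * w)
          = ?\<Delta> * (d * w - b)"
        by (simp add: algebra_simps)
      have "\<alpha> * adj_map w + \<beta> = (d * w - b) / (cnj d - cnj b * w)"
        unfolding 1 2 by (rule mult_divide_mult_cancel_left[OF D])
      then show ?thesis
        using True adj_map_in_disk[OF True]
        by (simp add: s_def blaschke_def multiplication_operator_def composition_operator_def)
    qed (simp add: blaschke_def multiplication_operator_def composition_operator_def)
  qed
  show thesis
    by (rule that[OF adjoint_operator_H2[OF bounded_operator_inverse_linear[OF pole_outside] s]
          trans[OF adjoint_of_lift[OF s] eq]])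
qed

text \<open>Only the weak inequality comes out, since the growth argument needs an open set on which
  \<open>B \<circ> \<tau>\<close> exceeds 1 in modulus.\<close>

lemma quotient_bounded_if_posinormal:
  assumes pn: "posinormal (composition_operator lf_map)" and y0: "y0 \<in> unit_disk"
  shows "cmod (num y0) \<le> cmod (den y0)"
proof (rule ccontr)
  let ?C = "composition_operator lf_map"
  let ?T = "adjoint_operator (multiplication_operator (\<lambda>z. c * z + d))"
  \<comment> \<open>\<open>N / M\<close> is \<open>B \<circ> \<tau>\<close> with \<open>den\<close>
    cleared, so possible poles of \<tau> in the disk do no harm.\<close>
  define N where "N y = d * num y - b * den y" for y
  define M where "M y = cnj d * den y - cnj b * num y" for y
  assume "\<not> ?thesis"
  then have y0': "cmod (M y0) < cmod (N y0)"
    unfolding N_def M_def using blaschke_le_iff by (simp add: not_le[symmetric])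
  note T = bounded_operator_adjoint[OF bounded_operator_linear[of c d]]
  obtain L where L: "L > 0" "\<And>f. f \<in> H2 \<Longrightarrow> H2_norm (?T f) \<le> L * H2_norm f"
    using bounded_operator_bound[OF T] by blast
  obtain K where K: "K > 0"
    "\<And>f. f \<in> H2 \<Longrightarrow> \<exists>u\<in>H2. ?C (adjoint_operator ?C f) = adjoint_operator ?C u \<and>
        (H2_norm u)\<^sup>2 \<le> K * (H2_norm (adjoint_operator ?C f))\<^sup>2"
    using posinormal_factor[OF pn] by blast
  define B where "B = L * sqrt (K * (H2_norm (blaschke 0))\<^sup>2)"
  \<comment> \<open>Posinormality gives \<open>u\<close> with norm controlled by that of
    \<open>blaschke n\<close>; Cowen's formula then holds with
    \<open>F = T\<^sub>h\<^sup>* u\<close>. The bound \<open>B\<close> is independent of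
    \<open>n\<close>.\<close>
  have "\<exists>F\<in>H2. H2_norm F \<le> B \<and> ?C (blaschke n) =
      multiplication_operator weight (composition_operator adj_map F)" for n
  proof -
    obtain f where f: "f \<in> H2" "adjoint_operator ?C f = blaschke n"
      using blaschke_in_range by blast
    obtain u where u: "u \<in> H2" "?C (blaschke n) = adjoint_operator ?C u"
      "(H2_norm u)\<^sup>2 \<le> K * (H2_norm (blaschke n))\<^sup>2"
      using K(2)[OF f(1)] unfolding f(2) by blast
    have "(H2_norm (blaschke n))\<^sup>2 \<le> (H2_norm (blaschke 0))\<^sup>2"
      using blaschke_H2[of n] H2_norm_nonneg by (intro power_mono) auto
    then have "(H2_norm u)\<^sup>2 \<le> K * (H2_norm (blaschke 0))\<^sup>2"
      using u(3) K(1) by (meson mult_left_mono less_imp_le order_trans)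
    then have "H2_norm u \<le> sqrt (K * (H2_norm (blaschke 0))\<^sup>2)" by (rule real_le_rsqrt)
    then have "L * H2_norm u \<le> B" unfolding B_def using L(1) by simp
    then have "H2_norm (?T u) \<le> B" using L(2)[OF u(1)] by simp
    then show ?thesis
      using bounded_operator_H2[OF T u(1)] u(2) adjoint_formula[OF u(1)] by (intro bexI[of _ "?T u"]) auto
  qed
  then obtain F where F: "\<And>n. F n \<in> H2" "\<And>n. H2_norm (F n) \<le> B"
    and CF: "\<And>n. ?C (blaschke n) = multiplication_operator weight (composition_operator adj_map (F n))"
    by metis
  have val: "weight (lf_map w) * ((d * lf_map w - b) / (cnj d - cnj b * lf_map w)) ^ n = weight w * F n (adj_map w)"
    if w: "w \<in> unit_disk" for n w
    using fun_cong[OF CF[of n], of w] w lf_map_in_disk[OF w]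
    by (simp add: composition_operator_def multiplication_operator_def blaschke_def)
  let ?U = "adj_map ` unit_disk"
  have U: "open ?U" "?U \<subseteq> unit_disk" "?U \<noteq> {}"
    using open_mapping_thm3[OF adj_map_holomorphic open_ball adj_map_inj] adj_map_in_disk by auto
  have hol: "F n holomorphic_on unit_disk" "N holomorphic_on unit_disk" "M holomorphic_on unit_disk" for n
    unfolding N_def M_def num_def den_def
    by (rule H2_holomorphic[OF F(1)], intro holomorphic_intros, intro holomorphic_intros)
  have local_eq: "F n y * M y ^ n = F 0 y * N y ^ n" if "y \<in> ?U" for n y
  proof -
    obtain w where w: "w \<in> unit_disk" "y = adj_map w" using \<open>y \<in> ?U\<close> by blast
    have num: "num y = lf_map w * den y"
      using quotient_adj_map[OF w(1)] den_adj_map_nonzero[OF w(1)] by (simp add: w(2) field_simps)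
    have nz: "cnj d - cnj b * lf_map w \<noteq> 0" "- cnj b * w + cnj d \<noteq> 0"
      using weight_nonzero[of "lf_map w"] weight_nonzero[of w] lf_map_in_disk[OF w(1)] w(1) by auto
    have N: "N y = (d * lf_map w - b) * den y" and M: "M y = (cnj d - cnj b * lf_map w) * den y"
      by (auto simp: N_def M_def num algebra_simps)
    have weight0: "weight (lf_map w) = weight w * F 0 y"
      using val[OF w(1), of 0] unfolding w(2) by (simp only: power_0 mult_1_right)
    have "weight w * F n y = weight w * (F 0 y * ((d * lf_map w - b) / (cnj d - cnj b * lf_map w)) ^ n)"
      using val[OF w(1), of n] unfolding w(2)[symmetric] weight0 by (simp only: mult.assoc)
    then have "F n y = F 0 y * ((d * lf_map w - b) / (cnj d - cnj b * lf_map w)) ^ n"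
      using nz by simp
    then show ?thesis using nz by (simp add: N M power_divide power_mult_distrib)
  qed
  \<comment> \<open>The relation is known only on the image of \<sigma>, which is open and nonempty;
    the identity theorem extends it to the disk.\<close>
  have global_eq: "F n y * M y ^ n = F 0 y * N y ^ n" if "y \<in> unit_disk" for n y
    by (rule analytic_continuation_open[OF U(1) open_ball U(3) _ U(2) _ _ local_eq that])
      (auto intro!: holomorphic_intros hol)
  \<comment> \<open>Here \<open>F 0 y = F n y * (M y / N y) ^ n\<close>, with \<open>F n y\<close>
    bounded in \<open>n\<close> and the power tending to 0.\<close>
  have vanish: "F 0 y = 0" if y: "y \<in> unit_disk" and less: "cmod (M y) < cmod (N y)" for y
  proof -
    have Nz: "cmod (N y) > 0" using less by (meson le_less_trans norm_ge_zero)
    have "cmod (F 0 y) \<le> B / sqrt (1 - (cmod y)\<^sup>2) * (cmod (M y) / cmod (N y)) ^ n" for n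
    proof -
      have "F 0 y = F n y * (M y / N y) ^ n"
        using global_eq[OF y, of n] Nz by (simp add: power_divide field_simps)
      then have norm_eq: "cmod (F 0 y) = cmod (F n y) * (cmod (M y) / cmod (N y)) ^ n"
        by (simp add: norm_mult norm_divide norm_power power_divide)
      have bound: "cmod (F n y) \<le> B / sqrt (1 - (cmod y)\<^sup>2)"
        by (rule order_trans[OF H2_pointwise_bound[OF F(1) y] divide_right_mono[OF F(2)]])
          (use y in \<open>auto simp: abs_square_le_1\<close>)
      show ?thesis unfolding norm_eq by (intro mult_right_mono bound) simp
    qed
    moreover have "(\<lambda>n. B / sqrt (1 - (cmod y)\<^sup>2) * (cmod (M y) / cmod (N y)) ^ n) \<longlonglongrightarrow> B / sqrt (1 - (cmod y)\<^sup>2) * 0"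
      by (intro tendsto_intros LIMSEQ_realpow_zero) (use less Nz in auto)
    ultimately have "cmod (F 0 y) \<le> 0" by (intro LIMSEQ_le_const[where X="\<lambda>n. _ n"]) auto
    then show ?thesis by simp
  qed
  let ?V = "unit_disk \<inter> {y. cmod (M y) < cmod (N y)}"
  have "open ?V"
    unfolding N_def M_def num_def den_def
    by (intro open_Int open_ball open_Collect_less continuous_intros)
  \<comment> \<open>\<open>?V\<close> is open and contains \<open>y0\<close>, so \<open>F 0\<close>
    vanishes on the whole disk; the case \<open>n = 0\<close> of \<open>val\<close> then makes
    \<open>weight\<close> vanish at \<open>lf_map 0\<close>.\<close>
  then have "F 0 (adj_map 0) = 0"
    by (rule analytic_continuation_open[where s="?V" and s'=unit_disk and g="\<lambda>_. 0"])
      (use y0 y0' vanish hol adj_map_in_disk[of 0] in auto)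
  then have "weight (lf_map 0) = 0" using val[of 0 0] by simp
  then show False using weight_nonzero[of "lf_map 0"] lf_map_in_disk[of 0] by simp
qed

text \<open>The weak bound excludes poles, since numerator and denominator cannot vanish together.
  The quotient is injective, so its image of the disk is open and lies in the interior of the closed
  disk.\<close>

lemma quotient_selfmap_if_posinormal:
  assumes pn: "posinormal (composition_operator lf_map)" and y0: "y0 \<in> unit_disk"
  shows "cmod (num y0) < cmod (den y0)"
proof -
  note le = quotient_bounded_if_posinormal[OF pn]
  have nz: "den y \<noteq> 0" if y: "y \<in> unit_disk" for y
  proof
    assume 0: "den y = 0"
    then have "num y = 0" using le[OF y] by simp
    with 0 show False using quotient_det unfolding num_def den_def by algebra
  qed
  let ?t = "\<lambda>y. num y / den y"
  have "?t holomorphic_on unit_disk"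
    using nz unfolding num_def den_def by (auto intro!: holomorphic_intros)
  moreover have "inj_on ?t unit_disk"
  proof (rule inj_onI)
    fix x y assume "x \<in> unit_disk" "y \<in> unit_disk" "?t x = ?t y"
    then have "num x * den y = num y * den x" using nz by (simp add: frac_eq_eq)
    then have "((a * cnj d + b * cnj b) * (c * cnj c + d * cnj a)
        - (a * cnj c + b * cnj a) * (c * cnj d + d * cnj b)) * (x - y) = 0"
      unfolding num_def den_def by algebra
    then show "x = y" using quotient_det by simp
  qed
  ultimately have "open (?t ` unit_disk)" using open_mapping_thm3 open_ball by blast
  moreover have "?t ` unit_disk \<subseteq> cball 0 1"
    using le nz by (auto simp: norm_divide)
  ultimately have "?t ` unit_disk \<subseteq> interior (cball 0 1)" by (rule interior_maximal[rotated])
  then have "cmod (?t y0) < 1" using y0 by (auto simp: image_subset_iff)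
  then show ?thesis using nz[OF y0] by (simp add: norm_divide divide_less_eq)
qed

end

section \<open>Transfer from functions on the disk to maps of the extended plane\<close>

theorem theorem2p1:
  fixes a b c d :: complex
    and \<phi> \<sigma> :: "extended_complex \<Rightarrow> extended_complex"
    and g h :: "complex \<Rightarrow> complex"
    and C_\<phi> C_\<sigma> T_g T_h :: operator
  assumes \<phi>: "\<phi> = linear_fractional a b c d"
    and \<phi>_selfmap: "disk_selfmap \<phi>"
    and \<phi>_nonconstant: "\<not> \<phi> constant_on (Fin ` unit_disk)"
    and \<sigma>: "\<sigma> = linear_fractional (cnj a) (- cnj c) (- cnj b) (cnj d)"
    and g: "g = (\<lambda>z. 1 / (- cnj b * z + cnj d))"
    and h: "h = (\<lambda>z. c * z + d)"
    and C_\<phi>: "C_\<phi> = composition_operator (on_disk \<phi>)"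
    and C_\<sigma>: "C_\<sigma> = composition_operator (on_disk \<sigma>)"
    and T_g: "T_g = multiplication_operator g"
    and T_h: "T_h = multiplication_operator h"
  shows "(analytic_disk_selfmap \<sigma> \<and> bounded_analytic g \<and> bounded_analytic h \<and>
          bounded_operator C_\<phi> \<and>
          (\<forall>f\<in>H2. adjoint_operator C_\<phi> f = T_g (C_\<sigma> (adjoint_operator T_h f)))) \<and>
         (posinormal C_\<phi> \<longrightarrow> analytic_disk_selfmap (\<phi> \<circ> inv \<sigma>)) \<and>
         ((\<exists>z\<in>unit_disk. \<phi> (Fin z) = Fin 0) \<and> disk_selfmap (\<phi> \<circ> inv \<sigma>)
            \<longrightarrow> posinormal C_\<phi>)"
proof -
  have "a * d - b * c \<noteq> 0"
    using linear_fractional_nonconstant[of a b c d] \<phi>_selfmap \<phi>_nonconstant \<phi> by simp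
  then interpret lf_selfmap a b c d
    using \<phi>_selfmap by unfold_locales (auto simp: \<phi> disk_selfmap_linear_fractional_iff)
  have analytic: "analytic_disk_selfmap (linear_fractional p q r s)"
    if det: "p * s - q * r \<noteq> 0" and self: "disk_selfmap (linear_fractional p q r s)" for p q r s
  proof -
    interpret l: lf_selfmap p q r s
      using det self by unfold_locales (auto simp: disk_selfmap_linear_fractional_iff)
    have "on_disk (linear_fractional p q r s) holomorphic_on unit_disk"
      by (rule holomorphic_transform[OF l.lf_map_holomorphic])
        (use l.closed_disk_nonzero in \<open>auto simp: on_disk_def l.lf_map_def\<close>)
    with self show ?thesis by (simp add: analytic_disk_selfmap_def)
  qed
  have C\<phi>: "C_\<phi> = composition_operator lf_map"
    unfolding C_\<phi> \<phi> composition_operator_def on_disk_def lf_map_def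
    using closed_disk_nonzero by (auto simp: fun_eq_iff)
  have C\<sigma>: "C_\<sigma> = composition_operator adj_map"
    unfolding C_\<sigma> \<sigma> composition_operator_def on_disk_def adj_map_def
    using adj_closed_disk_nonzero by (auto simp: fun_eq_iff)
  have "disk_selfmap \<sigma>"
    unfolding \<sigma> disk_selfmap_linear_fractional_iff using adj_less by blast
  with analytic[OF adj_det] have \<sigma>_analytic: "analytic_disk_selfmap \<sigma>" by (simp add: \<sigma>)
  have bounded: "bounded_analytic \<psi>" if "continuous_on (cball 0 1) \<psi>" "\<psi> holomorphic_on unit_disk" for \<psi>
    unfolding bounded_analytic_def
    using that bounded_subset[OF compact_imp_bounded[OF compact_continuous_image[OF that(1) compact_cball]]]
    by (meson ball_subset_cball image_mono)
  have g_analytic: "bounded_analytic g"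
    unfolding g using weight_nonzero
    by (intro bounded) (auto intro!: holomorphic_intros continuous_intros simp: cball_def)
  have h_analytic: "bounded_analytic h"
    unfolding h by (intro bounded holomorphic_intros continuous_intros)
  \<comment> \<open>The matrix of \<phi> times the adjugate of the matrix of \<sigma>, which gives
    the coefficients of \<open>num\<close> and \<open>den\<close>.\<close>
  have quotient: "\<phi> \<circ> inv \<sigma> = linear_fractional (a * cnj d + b * cnj b) (a * cnj c + b * cnj a)
      (c * cnj d + d * cnj b) (c * cnj c + d * cnj a)"
    unfolding \<phi> \<sigma> inv_linear_fractional[OF adj_det]
    using linear_fractional_compose[OF det, of "cnj d" "cnj a" "cnj c" "cnj b"] adj_det
    by (auto simp: fun_eq_iff mult.commute)
  have quotient_iff: "disk_selfmap (\<phi> \<circ> inv \<sigma>) \<longleftrightarrow> (\<forall>y\<in>unit_disk. cmod (num y) < cmod (den y))"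
    unfolding quotient disk_selfmap_linear_fractional_iff num_def den_def ..
  have "analytic_disk_selfmap (\<phi> \<circ> inv \<sigma>)" if "posinormal C_\<phi>"
    using quotient_selfmap_if_posinormal that analytic[OF quotient_det] quotient_iff
    unfolding C\<phi> quotient by blast
  moreover have "posinormal C_\<phi>"
    if zero: "\<exists>z\<in>unit_disk. \<phi> (Fin z) = Fin 0" and self: "disk_selfmap (\<phi> \<circ> inv \<sigma>)"
  proof -
    obtain z where z: "z \<in> unit_disk" "\<phi> (Fin z) = Fin 0" using zero by blast
    then have z2: "a * z + b = 0"
      using closed_disk_nonzero[of z] by (simp add: \<phi>)
    have "a \<noteq> 0" using det z2 by auto
    \<comment> \<open>A zero of \<phi> in the disk amounts to \<open>cmod b < cmod a\<close>, the
      form needed for bounding the multiplier in the factorization.\<close>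
    have "cmod b = cmod a * cmod z"
      using z2 by (metis add_eq_0_iff norm_minus_cancel norm_mult)
    also have "\<dots> < cmod a * 1" using z(1) \<open>a \<noteq> 0\<close> by (intro mult_strict_left_mono) auto
    finally show ?thesis
      using posinormal_if_quotient_selfmap self quotient_iff unfolding C\<phi> by simp
  qed
  ultimately show ?thesis
    using \<sigma>_analytic g_analytic h_analytic bounded_operator_map adjoint_formula
    unfolding C\<phi> C\<sigma> T_g T_h g h by blast
qed

end
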